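(* Let $n\ge2$, $o\in\mathbb S^{n-1}$, $0<R<\pi/2$, and set $\mathcal X:=\overline B_{\mathbb S}(o,R)$. Suppose the regularity assumption holds with constant $L>0$ and let $\nu:=\inf_{x\in\mathcal X}\|\operatorname{grad}f(x)\|_x>0$. Fix $a\ge2$ and define $$M_R:=\frac{2L\tan R}{\nu},\qquad K_R:=\max\left\{1,\left\lceil\frac{aL\tan R}{\nu}-a\right\rceil\right\},\qquad \widehat K_R:=\max\left\{K_R,\left\lceil\frac{2aL\tan R}{\nu}-a\right\rceil\right\}.$$ Then RFW-OL($a$) either terminates at an optimizer or generates an infinite sequence. In the latter case, for every $k\ge K_R$, $$h_k\le\frac{2a^2LR^2}{K_R+a-1}\exp\left(\frac{a^2L\tan R}{\nu(K_R+a-1)}\right)\left(\frac{K_R+a}{k+a}\right)^a.$$ Moreover, if $m:=\lfloor k/2\rfloor\ge\widehat K_R$ and $k\ge\lceil2a\rceil$, then $$g_k^{\rm rec}\le\frac{2h_m}{a\log(3/2)}.$$ Consequently, $h_k=O(k^{-a})$ and $g_k^{\rm rec}=O(k^{-a})$.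
   Context: $\mathbb S^{n-1}:=\{x\in\mathbb R^n:\|x\|_2=1\}$ is the unit round sphere with its standard Riemannian metric $\langle\cdot,\cdot\rangle_x$ (norm $\|\cdot\|_x$), exponential map $\operatorname{Exp}_x$, and geodesic distance $d_{\mathbb S}$; $\overline B_{\mathbb S}(o,R):=\{x\in\mathbb S^{n-1}:d_{\mathbb S}(x,o)\le R\}$. For $x\in\mathcal X$, the set of feasible minimizing initial velocities is $$\mathcal V(x):=\{v\in T_x\mathbb S^{n-1}:\ \operatorname{Exp}_x(v)\in\mathcal X,\ \|v\|_x=d_{\mathbb S}(x,\operatorname{Exp}_x(v)),\ \operatorname{Exp}_x(tv)\in\mathcal X\ \text{for all }t\in[0,1]\}.$$ The function $f$ is real-valued and differentiable on an open neighborhood of $\mathcal X$ in $\mathbb S^{n-1}$, with Riemannian gradient $\operatorname{grad}f$. Put $f^\star:=\min_{\mathcal X}f$ and $h(x):=f(x)-f^\star$; an optimizer is a minimizer of $f$ over $\mathcal X$. Regularity assumption (constant $L>0$): for all $x\in\mathcal X$, $v\in\mathcal V(x)$, $t\in[0,1]$, $f(\operatorname{Exp}_x(tv))\le(1-t)f(x)+tf(\operatorname{Exp}_x(v))$ and $f(\operatorname{Exp}_x(tv))\le f(x)+t\langle\operatorname{grad}f(x),v\rangle_x+\frac L2t^2\|v\|_x^2$. Algorithm RFW-OL($a$). Start from an arbitrary $x_0\in\mathcal X$. For $k=0,1,2,\dots$: choose any $v_k\in\arg\min_{v\in\mathcal V(x_k)}\langle\operatorname{grad}f(x_k),v\rangle_{x_k}$,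 set $g_k:=-\langle\operatorname{grad}f(x_k),v_k\rangle_{x_k}$; if $g_k=0$, terminate and return $x_k$; otherwise set $\eta_k:=a/(k+a)$ and $x_{k+1}:=\operatorname{Exp}_{x_k}(\eta_kv_k)$. Write $h_k:=h(x_k)$ and, for $k\ge2$, $g_k^{\rm rec}:=\min_{\lfloor k/2\rfloor\le j<k}g_j$. *)

theory Defs
  imports "HOL-Analysis.Analysis" "HOL-Library.Landau_Symbols"
begin

section \<open>Riemannian geometry of the unit sphere\<close>

text \<open>
  The unit sphere is \<^term>\<open>sphere 0 1\<close> in a Euclidean space, whose dimension plays the role of n.
  The round metric is the restriction of the ambient inner product to tangent spaces.
\<close>

definition tangent_space :: "'a::euclidean_space \<Rightarrow> 'a set" where
  "tangent_space x = {v. x \<bullet> v = 0}"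

text \<open>
  The Levi-Civita covariant acceleration of a curve on the sphere is the tangential part of its
  ambient second derivative.
\<close>

definition sphere_geodesic :: "(real \<Rightarrow> 'a::euclidean_space) \<Rightarrow> bool" where
  "sphere_geodesic \<gamma> \<longleftrightarrow> range \<gamma> \<subseteq> sphere 0 1 \<and>
     (\<exists>\<gamma>' \<gamma>''. \<forall>t. (\<gamma> has_vector_derivative \<gamma>' t) (at t) \<and>
        (\<gamma>' has_vector_derivative \<gamma>'' t) (at t) \<and>
        \<gamma>'' t - (\<gamma> t \<bullet> \<gamma>'' t) *\<^sub>R \<gamma> t = 0)"

definition sphere_exp :: "'a::euclidean_space \<Rightarrow> 'a \<Rightarrow> 'a" where
  "sphere_exp x v = (THE y. \<exists>\<gamma>. sphere_geodesic \<gamma> \<and> \<gamma> 0 = x \<and>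
     (\<gamma> has_vector_derivative v) (at 0) \<and> \<gamma> 1 = y)"

definition curve_length :: "(real \<Rightarrow> 'a::euclidean_space) \<Rightarrow> real" where
  "curve_length \<gamma> = integral {0..1} (\<lambda>t. norm (vector_derivative \<gamma> (at t)))"

text \<open>
  Infimum of the lengths of piecewise continuously differentiable curves on the sphere.
  Integrability has to be demanded: \<^const>\<open>valid_path\<close> lets the speed blow up at the finitely many
  breakpoints, and a curve of infinite length would be assigned the default value 0.
\<close>

definition sphere_dist :: "'a::euclidean_space \<Rightarrow> 'a \<Rightarrow> real" where
  "sphere_dist x y = Inf {curve_length \<gamma> |\<gamma>. valid_path \<gamma> \<and>
     (\<lambda>t. norm (vector_derivative \<gamma> (at t))) integrable_on {0..1} \<and>
     path_image \<gamma> \<subseteq> sphere 0 1 \<and> pathstart \<gamma> = x \<and> pathfinish \<gamma> = y}"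

definition sphere_cball :: "'a::euclidean_space \<Rightarrow> real \<Rightarrow> 'a set" where
  "sphere_cball p R = {x \<in> sphere 0 1. sphere_dist x p \<le> R}"

text \<open>
  The differential of f at x relative to the sphere is only determined on the tangent space at x;
  the Riemannian gradient is its unique tangent representative.
\<close>

definition sphere_grad :: "('a::euclidean_space \<Rightarrow> real) \<Rightarrow> 'a \<Rightarrow> 'a" where
  "sphere_grad f x = (THE g. g \<in> tangent_space x \<and>
     (f has_derivative (\<lambda>v. g \<bullet> v)) (at x within sphere 0 1))"


subsection \<open>Closed forms and well-definedness\<close>

lemma sphere_exp_eq:
  fixes x v :: "'a::euclidean_space"
  assumes x: "x \<in> sphere 0 1" and v: "v \<in> tangent_space x"
  shows "sphere_exp x v = cos (norm v) *\<^sub>R x + (sin (norm v) / norm v) *\<^sub>R v"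
proof -
  define c where "c = norm v"
  have xx: "x \<bullet> x = 1" using x by (simp add: dot_square_norm)
  have xv: "x \<bullet> v = 0" "v \<bullet> x = 0" using v by (auto simp: tangent_space_def inner_commute)
  have vv: "v \<bullet> v = c\<^sup>2" by (simp add: c_def dot_square_norm)
  show ?thesis unfolding sphere_exp_def c_def[symmetric]
  proof (rule the_equality)
    define \<gamma> where "\<gamma> t = cos (c * t) *\<^sub>R x + (sin (c * t) / c) *\<^sub>R v" for t
    define \<gamma>' where "\<gamma>' t = (- c * sin (c * t)) *\<^sub>R x + cos (c * t) *\<^sub>R v" for t
    define \<gamma>'' where "\<gamma>'' t = (- c\<^sup>2) *\<^sub>R \<gamma> t" for t
    have d1: "(\<gamma> has_vector_derivative \<gamma>' t) (at t)" for t
    proof (cases "c = 0")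
      case True
      then show ?thesis using c_def by (simp add: \<gamma>_def[abs_def] \<gamma>'_def)
    next
      case False
      then show ?thesis unfolding \<gamma>_def[abs_def] \<gamma>'_def
        by (auto intro!: derivative_eq_intros simp: algebra_simps)
    qed
    have d2: "(\<gamma>' has_vector_derivative \<gamma>'' t) (at t)" for t
    proof (cases "c = 0")
      case True
      then show ?thesis using c_def by (simp add: \<gamma>'_def[abs_def] \<gamma>''_def)
    next
      case False
      then show ?thesis unfolding \<gamma>_def[abs_def] \<gamma>'_def[abs_def] \<gamma>''_def
        by (auto intro!: derivative_eq_intros simp: algebra_simps power2_eq_square)
    qed
    have gg: "\<gamma> t \<bullet> \<gamma> t = 1" for t
    proof (cases "c = 0")
      case True
      then show ?thesis using xx by (simp add: \<gamma>_def)
    next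
      case False
      then have "\<gamma> t \<bullet> \<gamma> t = (cos (c*t))\<^sup>2 + (sin (c*t))\<^sup>2"
        by (simp add: \<gamma>_def inner_simps xx xv vv power2_eq_square)
      then show ?thesis by simp
    qed
    have "range \<gamma> \<subseteq> sphere 0 1" using gg by (auto simp: norm_eq_1)
    moreover have "\<gamma>'' t - (\<gamma> t \<bullet> \<gamma>'' t) *\<^sub>R \<gamma> t = 0" for t
      by (simp add: \<gamma>''_def gg)
    ultimately have "sphere_geodesic \<gamma>" unfolding sphere_geodesic_def using d1 d2 by blast
    moreover have "(\<gamma> has_vector_derivative v) (at 0)" using d1[of 0] by (simp add: \<gamma>'_def)
    ultimately show "\<exists>\<gamma>. sphere_geodesic \<gamma> \<and> \<gamma> 0 = x \<and> (\<gamma> has_vector_derivative v) (at 0) \<and>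
        \<gamma> 1 = cos c *\<^sub>R x + (sin c / c) *\<^sub>R v"
      by (intro exI[of _ \<gamma>]) (auto simp: \<gamma>_def)
  next
    fix y
    assume "\<exists>\<gamma>. sphere_geodesic \<gamma> \<and> \<gamma> 0 = x \<and> (\<gamma> has_vector_derivative v) (at 0) \<and> \<gamma> 1 = y"
    then obtain \<gamma> where geo: "sphere_geodesic \<gamma>" and g0: "\<gamma> 0 = x" and g1: "\<gamma> 1 = y"
      and v0: "(\<gamma> has_vector_derivative v) (at 0)" by auto
    from geo have rg: "range \<gamma> \<subseteq> sphere 0 1" by (simp add: sphere_geodesic_def)
    from geo obtain \<gamma>' \<gamma>'' where all: "\<forall>t. (\<gamma> has_vector_derivative \<gamma>' t) (at t) \<and>
        (\<gamma>' has_vector_derivative \<gamma>'' t) (at t) \<and> \<gamma>'' t - (\<gamma> t \<bullet> \<gamma>'' t) *\<^sub>R \<gamma> t = 0"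
      unfolding sphere_geodesic_def by (elim conjE exE)
    have d1: "(\<gamma> has_vector_derivative \<gamma>' t) (at t)" for t using all by simp
    have d2: "(\<gamma>' has_vector_derivative \<gamma>'' t) (at t)" for t using all by simp
    have ac: "\<gamma>'' t - (\<gamma> t \<bullet> \<gamma>'' t) *\<^sub>R \<gamma> t = 0" for t using all by simp
    have v0': "\<gamma>' 0 = v" using vector_derivative_at[OF v0] vector_derivative_at[OF d1[of 0]] by simp
    have gg: "\<gamma> t \<bullet> \<gamma> t = 1" for t
    proof -
      have "\<gamma> t \<in> sphere 0 1" using rg by blast
      then show ?thesis by (simp add: dot_square_norm)
    qed
    have const: "d = 0" if "((\<lambda>t. k) has_vector_derivative d) (at t)" for d k t :: real
      by (rule vector_derivative_unique_at[OF that has_vector_derivative_const])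
    have "((\<lambda>t. \<gamma> t \<bullet> \<gamma> t) has_vector_derivative (\<gamma> t \<bullet> \<gamma>' t + \<gamma>' t \<bullet> \<gamma> t)) (at t)" for t
      by (rule bounded_bilinear.has_vector_derivative[OF bounded_bilinear_inner d1 d1])
    then have "((\<lambda>t. 1) has_vector_derivative (\<gamma> t \<bullet> \<gamma>' t + \<gamma>' t \<bullet> \<gamma> t)) (at t)" for t
      by (simp add: gg)
    then have g1': "\<gamma> t \<bullet> \<gamma>' t = 0" for t
      using const by (fastforce simp: inner_commute)
    have "((\<lambda>t. \<gamma> t \<bullet> \<gamma>' t) has_vector_derivative (\<gamma> t \<bullet> \<gamma>'' t + \<gamma>' t \<bullet> \<gamma>' t)) (at t)" for t
      by (rule bounded_bilinear.has_vector_derivative[OF bounded_bilinear_inner d1 d2])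
    then have "((\<lambda>t. 0) has_vector_derivative (\<gamma> t \<bullet> \<gamma>'' t + \<gamma>' t \<bullet> \<gamma>' t)) (at t)" for t
      by (simp add: g1')
    then have g2': "\<gamma> t \<bullet> \<gamma>'' t = - (\<gamma>' t \<bullet> \<gamma>' t)" for t
      using const[of 0 _ t] by (simp add: eq_neg_iff_add_eq_0)
    have g3: "\<gamma>'' t = - (\<gamma>' t \<bullet> \<gamma>' t) *\<^sub>R \<gamma> t" for t using ac[of t] by (simp add: g2' add_eq_0_iff)
    have z: "((\<lambda>t. \<gamma>' t \<bullet> \<gamma>' t) has_vector_derivative 0) (at t)" for t
      using bounded_bilinear.has_vector_derivative[OF bounded_bilinear_inner d2[of t] d2[of t]] g1'[of t]
      by (simp add: g3 inner_commute)
    have sp: "\<gamma>' t \<bullet> \<gamma>' t = c\<^sup>2" for t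
    proof -
      obtain k where "\<And>s. \<gamma>' s \<bullet> \<gamma>' s = k"
        using has_vector_derivative_zero_constant[of UNIV "\<lambda>t. \<gamma>' t \<bullet> \<gamma>' t"] z by auto
      then show ?thesis using v0' vv by metis
    qed
    have g3': "\<gamma>'' t = - c\<^sup>2 *\<^sub>R \<gamma> t" for t using g3 sp by simp
    show "y = cos c *\<^sub>R x + (sin c / c) *\<^sub>R v"
    proof (cases "c = 0")
      case True
      then have "(\<gamma> has_vector_derivative 0) (at t)" for t using d1[of t] sp[of t] by simp
      then obtain k where "\<And>s. \<gamma> s = k"
        using has_vector_derivative_zero_constant[of UNIV "\<gamma>"] by auto
      then show ?thesis using g0 g1 True by simp
    next
      case False
      have "((\<lambda>t. cos (c*t) *\<^sub>R \<gamma> t - (sin (c*t) / c) *\<^sub>R \<gamma>' t) has_vector_derivative 0) (at t)" for t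
        using False
        by (auto intro!: derivative_eq_intros d1 d2 simp: g3' algebra_simps power2_eq_square)
      then obtain A where A: "\<And>s. cos (c * s) *\<^sub>R \<gamma> s - (sin (c * s) / c) *\<^sub>R \<gamma>' s = A"
        using has_vector_derivative_zero_constant[of UNIV "\<lambda>t. cos (c*t) *\<^sub>R \<gamma> t - (sin (c*t) / c) *\<^sub>R \<gamma>' t"] by auto
      have "((\<lambda>t. (c * sin (c*t)) *\<^sub>R \<gamma> t + cos (c*t) *\<^sub>R \<gamma>' t) has_vector_derivative 0) (at t)" for t
        using False
        by (auto intro!: derivative_eq_intros d1 d2 simp: g3' algebra_simps power2_eq_square)
      then obtain B where B: "\<And>s. (c * sin (c * s)) *\<^sub>R \<gamma> s + cos (c * s) *\<^sub>R \<gamma>' s = B"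
        using has_vector_derivative_zero_constant[of UNIV "\<lambda>t. (c * sin (c*t)) *\<^sub>R \<gamma> t + cos (c*t) *\<^sub>R \<gamma>' t"] by auto
      have AB: "A = x" "B = v" using A[of 0] B[of 0] g0 v0' by auto
      have "cos c *\<^sub>R A + (sin c / c) *\<^sub>R B = ((cos c)\<^sup>2 + (sin c)\<^sup>2) *\<^sub>R \<gamma> 1"
        using False unfolding A[of 1, symmetric] B[of 1, symmetric]
        by (simp add: algebra_simps power2_eq_square
            del: sin_cos_squared_add sin_cos_squared_add2 sin_cos_squared_add3)
      then show ?thesis using AB g1 by simp
    qed
  qed
qed

lemma sphere_dist_lower:
  fixes x y :: "'a::euclidean_space"
  assumes vp: "valid_path \<gamma>" and int: "(\<lambda>t. norm (vector_derivative \<gamma> (at t))) integrable_on {0..1}"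
    and img: "path_image \<gamma> \<subseteq> sphere 0 1" and ps: "pathstart \<gamma> = x" and pf: "pathfinish \<gamma> = y"
  shows "arccos (x \<bullet> y) \<le> curve_length \<gamma>"
proof -
  let ?n = "\<lambda>t. norm (vector_derivative \<gamma> (at t))"
  obtain S where S: "finite S" "\<gamma> C1_differentiable_on ({0..1} - S)" and cont: "continuous_on {0..1} \<gamma>"
    using vp by (auto simp: valid_path_def piecewise_C1_differentiable_on_def)
  have nrm: "norm (\<gamma> t) = 1" if "t \<in> {0..1}" for t using img that by (force simp: path_image_def)
  have gg: "\<gamma> t \<bullet> \<gamma> t = 1" if "t \<in> {0..1}" for t using nrm that by (auto simp: norm_eq_1)
  have x0: "\<gamma> 0 = x" and y1: "\<gamma> 1 = y" using ps pf by (auto simp: pathstart_def pathfinish_def)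
  have xx: "x \<bullet> x = 1" using gg[of 0] x0 by simp
  have nx: "norm x = 1" using xx by (simp add: norm_eq_1)
  have cb: "\<bar>x \<bullet> \<gamma> t\<bar> \<le> 1" if "t \<in> {0..1}" for t
    using Cauchy_Schwarz_ineq2[of x "\<gamma> t"] nx nrm[OF that] by simp
  define \<phi> where "\<phi> t = arccos (x \<bullet> \<gamma> t)" for t
  have cphi: "continuous_on {0..1} \<phi>" unfolding \<phi>_def
    by (intro continuous_intros cont ballI) (use cb in force)
  have p0: "\<phi> 0 = 0" by (simp add: \<phi>_def x0 xx)
  define \<theta> where "\<theta> = arccos (x \<bullet> y)"
  have p1: "\<phi> 1 = \<theta>" by (simp add: \<phi>_def \<theta>_def y1)
  have bnd: "0 \<le> \<phi> t \<and> \<phi> t \<le> pi" if "t \<in> {0..1}" for t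
    using cb[OF that] unfolding \<phi>_def by (intro conjI arccos_lbound arccos_ubound) auto
  have th: "0 \<le> \<theta>" "\<theta> \<le> pi" using bnd[of 1] p1 by auto
  have len0: "0 \<le> curve_length \<gamma>" unfolding curve_length_def by (rule integral_nonneg[OF int]) auto
  show ?thesis
  proof (cases "\<theta> = 0")
    case True
    then show ?thesis using len0 \<theta>_def by simp
  next
    case False
    then have thp: "\<theta> > 0" using th by simp
    define T where "T = {t \<in> {0..1}. \<phi> t = \<theta>}"
    have cT: "closed T" unfolding T_def
      using continuous_closed_preimage_constant[OF cphi] by simp
    have "1 \<in> T" using p1 by (simp add: T_def)
    define t1 where "t1 = Inf T"
    have bT: "bdd_below T" by (auto simp: T_def intro: bdd_belowI[of _ 0])
    have t1: "t1 \<in> T" unfolding t1_def using closed_contains_Inf[OF _ bT cT] \<open>1 \<in> T\<close> by blast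
    have t1': "t1 \<in> {0..1}" "\<phi> t1 = \<theta>" using t1 by (auto simp: T_def)
    have lt: "\<phi> t < \<theta>" if "0 \<le> t" "t < t1" for t
    proof (rule ccontr)
      assume "\<not> \<phi> t < \<theta>"
      then have "\<exists>s\<ge>0. s \<le> t \<and> \<phi> s = \<theta>"
        by (intro IVT') (use that p0 thp t1' in \<open>auto intro: continuous_on_subset[OF cphi]\<close>)
      then obtain s where "0 \<le> s" "s \<le> t" "\<phi> s = \<theta>" by blast
      then have "s \<in> T" using that t1' by (auto simp: T_def)
      then have "t1 \<le> s" unfolding t1_def by (rule cInf_lower[OF _ bT])
      then show False using \<open>s \<le> t\<close> that by simp
    qed
    define Z where "Z = {t \<in> {0..t1}. \<phi> t = 0}"
    have cZ: "closed Z" unfolding Z_def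
      using continuous_closed_preimage_constant[of "{0..t1}" \<phi> 0] continuous_on_subset[OF cphi, of "{0..t1}"] t1' by auto
    have "0 \<in> Z" using p0 t1' by (simp add: Z_def)
    define t0 where "t0 = Sup Z"
    have bZ: "bdd_above Z" by (auto simp: Z_def intro: bdd_aboveI[of _ t1])
    have t0: "t0 \<in> Z" unfolding t0_def using closed_contains_Sup[OF _ bZ cZ] \<open>0 \<in> Z\<close> by blast
    have t0': "0 \<le> t0" "t0 \<le> t1" "\<phi> t0 = 0" using t0 by (auto simp: Z_def)
    have pos: "0 < \<phi> t" if "t0 < t" "t \<le> t1" for t
    proof -
      have "t \<notin> Z" using cSup_upper[OF _ bZ, of t] that t0_def by fastforce
      then show ?thesis using that t0' t1' bnd[of t] by (auto simp: Z_def)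
    qed
    define F where "F t = inverse (- sqrt (1 - (x \<bullet> \<gamma> t)\<^sup>2)) * (x \<bullet> vector_derivative \<gamma> (at t))" for t
    have key: "(\<phi> has_vector_derivative F t) (at t) \<and> norm (F t) \<le> ?n t"
      if t: "t \<in> {t0<..<t1} - S" for t
    proof -
      have tI: "t \<in> {0..1}" "t \<in> {0<..<1}" using t t0' t1' by auto
      have dg: "(\<gamma> has_vector_derivative vector_derivative \<gamma> (at t)) (at t)"
        using S(2) t tI by (auto simp: C1_differentiable_on_eq vector_derivative_works)
      have "0 < \<phi> t" "\<phi> t < pi" using pos[of t] lt[of t] t t0' th by auto
      then have ne: "x \<bullet> \<gamma> t \<noteq> 1" "x \<bullet> \<gamma> t \<noteq> -1" by (auto simp: \<phi>_def)
      then have c: "-1 < x \<bullet> \<gamma> t" "x \<bullet> \<gamma> t < 1" using cb[OF tI(1)] by auto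
      have dc: "((\<lambda>t. x \<bullet> \<gamma> t) has_vector_derivative (x \<bullet> vector_derivative \<gamma> (at t))) (at t)"
        by (rule bounded_linear.has_vector_derivative[OF bounded_linear_inner_right dg])
      have 1: "(\<phi> has_vector_derivative F t) (at t)"
        unfolding \<phi>_def[abs_def] F_def
        using DERIV_chain2[OF DERIV_arccos[OF c] dc[unfolded has_real_derivative_iff_has_vector_derivative[symmetric]]]
        by (simp add: has_real_derivative_iff_has_vector_derivative)
      have "((\<lambda>t. \<gamma> t \<bullet> \<gamma> t) has_vector_derivative
          (\<gamma> t \<bullet> vector_derivative \<gamma> (at t) + vector_derivative \<gamma> (at t) \<bullet> \<gamma> t)) (at t)"
        by (rule bounded_bilinear.has_vector_derivative[OF bounded_bilinear_inner dg dg])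
      then have "((\<lambda>t. 1) has_vector_derivative
          (\<gamma> t \<bullet> vector_derivative \<gamma> (at t) + vector_derivative \<gamma> (at t) \<bullet> \<gamma> t)) (at t)"
        by (rule has_vector_derivative_transform_within_open[where S="{0<..<1}"]) (use tI gg in auto)
      then have orth: "\<gamma> t \<bullet> vector_derivative \<gamma> (at t) = 0"
        using vector_derivative_at[of "\<lambda>t. 1::real" _ t] by (fastforce simp: inner_commute)
      let ?p = "x - (x \<bullet> \<gamma> t) *\<^sub>R \<gamma> t"
      have np: "norm ?p = sqrt (1 - (x \<bullet> \<gamma> t)\<^sup>2)"
        by (simp add: norm_eq_sqrt_inner inner_simps xx gg[OF tI(1)] inner_commute power2_eq_square)
      have sq: "(x \<bullet> \<gamma> t)\<^sup>2 < 1" using c by (simp add: abs_square_less_1)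
      have "\<bar>x \<bullet> vector_derivative \<gamma> (at t)\<bar> = \<bar>?p \<bullet> vector_derivative \<gamma> (at t)\<bar>"
        by (simp add: inner_simps orth)
      also have "\<dots> \<le> norm ?p * ?n t" by (rule Cauchy_Schwarz_ineq2)
      finally have "\<bar>x \<bullet> vector_derivative \<gamma> (at t)\<bar> \<le> sqrt (1 - (x \<bullet> \<gamma> t)\<^sup>2) * ?n t" using np by simp
      then have "norm (F t) \<le> ?n t" using sq by (simp add: F_def abs_mult field_simps)
      with 1 show ?thesis by blast
    qed
    define F' where "F' t = (if t \<in> {t0<..<t1} - S then F t else 0)" for t
    have "(F' has_integral (\<phi> t1 - \<phi> t0)) {t0..t1}"
      by (rule fundamental_theorem_of_calculus_interior_strong[OF S(1) t0'(2)])
         (use key t0' t1' in \<open>auto simp: F'_def intro: continuous_on_subset[OF cphi]\<close>)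
    then have I: "F' integrable_on {t0..t1}" "integral {t0..t1} F' = \<theta>"
      using t0' t1' by (auto simp: has_integral_iff)
    have sub: "{t0..t1} \<subseteq> {0..1}" using t0' t1' by auto
    have int': "?n integrable_on {t0..t1}" using integrable_on_subinterval[OF int sub] .
    have "norm (integral {t0..t1} F') \<le> integral {t0..t1} ?n"
      by (rule integral_norm_bound_integral[OF I(1) int']) (use key in \<open>auto simp: F'_def\<close>)
    also have "\<dots> \<le> integral {0..1} ?n" by (rule integral_subset_le[OF sub int' int]) auto
    finally show ?thesis using I(2) th by (simp add: curve_length_def \<theta>_def)
  qed
qed

lemma sphere_dist_eq_arccos:
  fixes x y :: "'a::euclidean_space"
  assumes dim: "DIM('a) \<ge> 2" and x: "x \<in> sphere 0 1" and y: "y \<in> sphere 0 1"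
  shows "sphere_dist x y = arccos (x \<bullet> y)"
proof -
  have xx: "x \<bullet> x = 1" and yy: "y \<bullet> y = 1" using x y by (auto simp: dot_square_norm)
  have "\<bar>x \<bullet> y\<bar> \<le> 1" using Cauchy_Schwarz_ineq2[of x y] x y by simp
  then have cb: "-1 \<le> x \<bullet> y" "x \<bullet> y \<le> 1" by auto
  define \<theta> where "\<theta> = arccos (x \<bullet> y)"
  have ct: "cos \<theta> = x \<bullet> y" and st: "sin \<theta> = sqrt (1 - (x \<bullet> y)\<^sup>2)"
    using cb by (auto simp: \<theta>_def sin_arccos)
  have th0: "\<theta> \<ge> 0" using cb by (simp add: \<theta>_def arccos_lbound)
  obtain u where u: "u \<bullet> u = 1" "x \<bullet> u = 0" "y = cos \<theta> *\<^sub>R x + sin \<theta> *\<^sub>R u"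
  proof (cases "(x \<bullet> y)\<^sup>2 = 1")
    case True
    obtain w where w: "w \<noteq> 0" "orthogonal x w" using orthogonal_to_vector_exists[OF dim] by blast
    define u where "u = (1 / norm w) *\<^sub>R w"
    have "u \<bullet> u = 1" "x \<bullet> u = 0"
      using w by (auto simp: u_def orthogonal_def dot_square_norm power2_eq_square)
    moreover have "(y - (x \<bullet> y) *\<^sub>R x) \<bullet> (y - (x \<bullet> y) *\<^sub>R x) = 0"
      using True by (simp add: inner_simps xx yy inner_commute power2_eq_square)
    then have "y = (x \<bullet> y) *\<^sub>R x" by simp
    ultimately show ?thesis using True ct st that[of u] by simp
  next
    case False
    have "(x \<bullet> y)\<^sup>2 \<le> 1" using \<open>\<bar>x \<bullet> y\<bar> \<le> 1\<close> by (simp add: abs_square_le_1)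
    with False have s: "sin \<theta> > 0" "(sin \<theta>)\<^sup>2 = 1 - (x \<bullet> y)\<^sup>2" by (auto simp: st)
    define u where "u = (1 / sin \<theta>) *\<^sub>R (y - (x \<bullet> y) *\<^sub>R x)"
    have "u \<bullet> u = (1 - (x \<bullet> y)\<^sup>2) / (sin \<theta>)\<^sup>2"
      by (simp add: u_def inner_simps xx yy inner_commute power2_eq_square add_divide_distrib[symmetric])
    then have "u \<bullet> u = 1" using s by (metis divide_self less_irrefl power_not_zero)
    moreover have "x \<bullet> u = 0" by (simp add: u_def inner_simps xx)
    moreover have "y = cos \<theta> *\<^sub>R x + sin \<theta> *\<^sub>R u" using s ct by (simp add: u_def)
    ultimately show ?thesis using that by blast
  qed
  have ux: "u \<bullet> x = 0" using u by (simp add: inner_commute)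
  define \<gamma> where "\<gamma> t = cos (\<theta> * t) *\<^sub>R x + sin (\<theta> * t) *\<^sub>R u" for t
  define \<gamma>' where "\<gamma>' t = (- \<theta> * sin (\<theta> * t)) *\<^sub>R x + (\<theta> * cos (\<theta> * t)) *\<^sub>R u" for t
  have d: "(\<gamma> has_vector_derivative \<gamma>' t) (at t)" for t
    unfolding \<gamma>_def[abs_def] \<gamma>'_def by (auto intro!: derivative_eq_intros simp: algebra_simps)
  have vd: "vector_derivative \<gamma> (at t) = \<gamma>' t" for t using d by (rule vector_derivative_at)
  have cd: "continuous_on A \<gamma>'" for A unfolding \<gamma>'_def by (intro continuous_intros)
  have "\<gamma> C1_differentiable_on {0..1}"
    unfolding C1_differentiable_on_eq vd using d cd by (auto intro: differentiableI_vector)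
  then have vp: "valid_path \<gamma>" unfolding valid_path_def by (rule C1_differentiable_imp_piecewise)
  have "\<gamma>' t \<bullet> \<gamma>' t = \<theta>\<^sup>2 * ((sin (\<theta> * t))\<^sup>2 + (cos (\<theta> * t))\<^sup>2)" for t
    unfolding \<gamma>'_def
    by (simp add: inner_simps xx u ux power2_eq_square algebra_simps del: sin_cos_squared_add sin_cos_squared_add2 sin_cos_squared_add3)
  then have nd: "norm (\<gamma>' t) = \<theta>" for t using th0 by (simp add: norm_eq_sqrt_inner)
  have "\<gamma> t \<bullet> \<gamma> t = (cos (\<theta> * t))\<^sup>2 + (sin (\<theta> * t))\<^sup>2" for t
    unfolding \<gamma>_def by (simp add: inner_simps xx u ux power2_eq_square algebra_simps)
  then have im: "path_image \<gamma> \<subseteq> sphere 0 1" by (auto simp: path_image_def norm_eq_1)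
  have mem: "\<theta> \<in> {curve_length \<gamma> |\<gamma>. valid_path \<gamma> \<and>
     (\<lambda>t. norm (vector_derivative \<gamma> (at t))) integrable_on {0..1} \<and>
     path_image \<gamma> \<subseteq> sphere 0 1 \<and> pathstart \<gamma> = x \<and> pathfinish \<gamma> = y}"
    by (rule CollectI, rule exI[of _ \<gamma>])
       (use vp im u in \<open>auto simp: curve_length_def vd nd pathstart_def pathfinish_def \<gamma>_def\<close>)
  show ?thesis unfolding sphere_dist_def \<theta>_def[symmetric]
    by (rule cInf_eq_minimum[OF mem]) (auto simp: \<theta>_def intro: sphere_dist_lower)
qed

lemma sphere_grad_unique:
  fixes x :: "'a::euclidean_space"
  assumes x: "x \<in> sphere 0 1"
    and g: "g \<in> tangent_space x" "(f has_derivative (\<lambda>v. g \<bullet> v)) (at x within sphere 0 1)"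
    and h: "h \<in> tangent_space x" "(f has_derivative (\<lambda>v. h \<bullet> v)) (at x within sphere 0 1)"
  shows "g = h"
proof (rule ccontr)
  assume ne: "g \<noteq> h"
  define w where "w = (1 / norm (g - h)) *\<^sub>R (g - h)"
  have xx: "x \<bullet> x = 1" using x by (simp add: dot_square_norm)
  have ww: "w \<bullet> w = 1" using ne by (simp add: w_def dot_square_norm power2_eq_square)
  have xw: "x \<bullet> w = 0" using g(1) h(1) by (simp add: w_def tangent_space_def inner_simps)
  have wx: "w \<bullet> x = 0" using xw by (simp add: inner_commute)
  define \<gamma> where "\<gamma> t = cos t *\<^sub>R x + sin t *\<^sub>R w" for t
  have "\<gamma> t \<bullet> \<gamma> t = 1" for t
  proof -
    have "\<gamma> t \<bullet> \<gamma> t = (cos t)\<^sup>2 + (sin t)\<^sup>2"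
      by (simp add: \<gamma>_def inner_simps xx xw wx ww power2_eq_square)
    then show ?thesis by simp
  qed
  then have rg: "range \<gamma> \<subseteq> sphere 0 1" by (auto simp: norm_eq_1)
  have d: "(\<gamma> has_derivative (\<lambda>t. t *\<^sub>R w)) (at 0)"
  proof -
    have "(\<gamma> has_vector_derivative w) (at 0)" unfolding \<gamma>_def[abs_def]
      by (auto intro!: derivative_eq_intros)
    then show ?thesis by (simp add: has_vector_derivative_def)
  qed
  have *: "((\<lambda>t. f (\<gamma> t)) has_derivative (\<lambda>t. k \<bullet> (t *\<^sub>R w))) (at 0)"
    if "(f has_derivative (\<lambda>v. k \<bullet> v)) (at x within sphere 0 1)" for k
  proof -
    have "(f has_derivative (\<lambda>v. k \<bullet> v)) (at (\<gamma> 0) within \<gamma> ` UNIV)"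
      using that rg by (auto simp: \<gamma>_def intro: has_derivative_subset)
    from has_derivative_in_compose[OF d this] show ?thesis by simp
  qed
  have "(\<lambda>t. g \<bullet> (t *\<^sub>R w)) = (\<lambda>t. h \<bullet> (t *\<^sub>R w))"
    by (rule has_derivative_unique[OF *[OF g(2)] *[OF h(2)]])
  then have "g \<bullet> (1 *\<^sub>R w) = h \<bullet> (1 *\<^sub>R w)" by meson
  then have "(g - h) \<bullet> (g - h) = 0" using ne by (simp add: w_def inner_simps)
  then show False using ne by simp
qed

lemma sphere_grad_exists:
  fixes x :: "'a::euclidean_space"
  assumes x: "x \<in> sphere 0 1" and f: "f differentiable (at x within sphere 0 1)"
  shows "\<exists>g. g \<in> tangent_space x \<and> (f has_derivative (\<lambda>v. g \<bullet> v)) (at x within sphere 0 1)"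
proof -
  have xx: "x \<bullet> x = 1" using x by (simp add: dot_square_norm)
  obtain D where D: "(f has_derivative D) (at x within sphere 0 1)" using f by (auto simp: differentiable_def)
  then have lin: "linear D" by (rule has_derivative_linear)
  define G where "G = (\<Sum>b\<in>Basis. D b *\<^sub>R b)"
  have DG: "D v = G \<bullet> v" for v
  proof -
    have "D v = D (\<Sum>b\<in>Basis. (v \<bullet> b) *\<^sub>R b)" by (simp add: euclidean_representation)
    also have "\<dots> = (\<Sum>b\<in>Basis. (v \<bullet> b) * D b)" using lin by (simp add: linear_sum linear_scale)
    finally show ?thesis by (simp add: G_def inner_commute[of _ v] inner_sum_right mult.commute)
  qed
  define g where "g = G - (G \<bullet> x) *\<^sub>R x"
  have g: "g \<in> tangent_space x" by (simp add: tangent_space_def g_def inner_simps xx inner_commute)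
  \<comment> \<open>the norm constraint function vanishes on the sphere, so multiples of its derivative may be added\<close>
  have s: "((\<lambda>y. y \<bullet> y - 1) has_derivative (\<lambda>v. 2 * (x \<bullet> v))) (at x within sphere 0 1)"
    by (auto intro!: derivative_eq_intros simp: inner_commute)
  have "((\<lambda>y. f y - (G \<bullet> x) / 2 * (y \<bullet> y - 1)) has_derivative (\<lambda>v. D v - (G \<bullet> x) / 2 * (2 * (x \<bullet> v)))) (at x within sphere 0 1)"
    by (intro has_derivative_diff D has_derivative_mult_right s)
  then have "((\<lambda>y. f y - (G \<bullet> x) / 2 * (y \<bullet> y - 1)) has_derivative (\<lambda>v. g \<bullet> v)) (at x within sphere 0 1)"
    by (simp add: DG g_def inner_simps)
  then have "(f has_derivative (\<lambda>v. g \<bullet> v)) (at x within sphere 0 1)"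
    by (rule has_derivative_transform[rotated 2]) (use x in \<open>auto simp: dot_square_norm\<close>)
  with g show ?thesis by blast
qed


section \<open>Riemannian Frank-Wolfe with open-loop step sizes\<close>

definition feasible_velocities :: "'a::euclidean_space set \<Rightarrow> 'a \<Rightarrow> 'a set" where
  "feasible_velocities X x = {v \<in> tangent_space x. sphere_exp x v \<in> X \<and>
     norm v = sphere_dist x (sphere_exp x v) \<and> (\<forall>t\<in>{0..1}. sphere_exp x (t *\<^sub>R v) \<in> X)}"

definition fw_regular :: "'a::euclidean_space set \<Rightarrow> ('a \<Rightarrow> real) \<Rightarrow> real \<Rightarrow> bool" where
  "fw_regular X f L \<longleftrightarrow> (\<forall>x\<in>X. \<forall>v\<in>feasible_velocities X x. \<forall>t\<in>{0..1}.
     f (sphere_exp x (t *\<^sub>R v)) \<le> (1 - t) * f x + t * f (sphere_exp x v) \<and>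
     f (sphere_exp x (t *\<^sub>R v)) \<le> f x + t * (sphere_grad f x \<bullet> v) + L / 2 * t\<^sup>2 * (norm v)\<^sup>2)"

definition fw_argmin :: "'a::euclidean_space set \<Rightarrow> ('a \<Rightarrow> real) \<Rightarrow> 'a \<Rightarrow> 'a set" where
  "fw_argmin X f x =
     {v. is_arg_min (\<lambda>v. sphere_grad f x \<bullet> v) (\<lambda>v. v \<in> feasible_velocities X x) v}"

definition fw_gap :: "('a::euclidean_space \<Rightarrow> real) \<Rightarrow> 'a \<Rightarrow> 'a \<Rightarrow> real" where
  "fw_gap f x v = - (sphere_grad f x \<bullet> v)"

text \<open>
  A run is given by iterates x and chosen directions v.
  \<^term>\<open>rfw_ol_prefix a X f x v K\<close>: iterations 0 to K - 1 were carried out without terminating,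
  so the iterate x K has been reached; values of x beyond K and of v from K on are unconstrained.
\<close>

definition rfw_ol_prefix ::
  "real \<Rightarrow> 'a::euclidean_space set \<Rightarrow> ('a \<Rightarrow> real) \<Rightarrow> (nat \<Rightarrow> 'a) \<Rightarrow> (nat \<Rightarrow> 'a) \<Rightarrow> nat \<Rightarrow> bool" where
  "rfw_ol_prefix a X f x v K \<longleftrightarrow> x 0 \<in> X \<and>
     (\<forall>k<K. v k \<in> fw_argmin X f (x k) \<and> fw_gap f (x k) (v k) \<noteq> 0 \<and>
        x (Suc k) = sphere_exp (x k) ((a / (real k + a)) *\<^sub>R v k))"

definition rfw_ol_terminates ::
  "real \<Rightarrow> 'a::euclidean_space set \<Rightarrow> ('a \<Rightarrow> real) \<Rightarrow> (nat \<Rightarrow> 'a) \<Rightarrow> (nat \<Rightarrow> 'a) \<Rightarrow> nat \<Rightarrow> bool" where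
  "rfw_ol_terminates a X f x v K \<longleftrightarrow> rfw_ol_prefix a X f x v K \<and>
     v K \<in> fw_argmin X f (x K) \<and> fw_gap f (x K) (v K) = 0"

definition rfw_ol_infinite ::
  "real \<Rightarrow> 'a::euclidean_space set \<Rightarrow> ('a \<Rightarrow> real) \<Rightarrow> (nat \<Rightarrow> 'a) \<Rightarrow> (nat \<Rightarrow> 'a) \<Rightarrow> bool" where
  "rfw_ol_infinite a X f x v \<longleftrightarrow> (\<forall>K. rfw_ol_prefix a X f x v K)"

text \<open>
  A complete execution: at every reached iterate a direction is chosen and, unless the gap
  vanishes, the update is performed. Entries after termination are unconstrained.
\<close>

definition rfw_ol_execution ::
  "real \<Rightarrow> 'a::euclidean_space set \<Rightarrow> ('a \<Rightarrow> real) \<Rightarrow> (nat \<Rightarrow> 'a) \<Rightarrow> (nat \<Rightarrow> 'a) \<Rightarrow> bool" where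
  "rfw_ol_execution a X f x v \<longleftrightarrow> x 0 \<in> X \<and>
     (\<forall>k. rfw_ol_prefix a X f x v k \<longrightarrow> v k \<in> fw_argmin X f (x k) \<and>
        (fw_gap f (x k) (v k) \<noteq> 0 \<longrightarrow>
           x (Suc k) = sphere_exp (x k) ((a / (real k + a)) *\<^sub>R v k)))"

text \<open>Meaningful for k at least 2, when the index set is nonempty.\<close>

definition gap_rec ::
  "('a::euclidean_space \<Rightarrow> real) \<Rightarrow> (nat \<Rightarrow> 'a) \<Rightarrow> (nat \<Rightarrow> 'a) \<Rightarrow> nat \<Rightarrow> real" where
  "gap_rec f x v k = Min ((\<lambda>j. fw_gap f (x j) (v j)) ` {k div 2..<k})"

end

theory Submission
  imports Defs
begin

text \<open>
  Convexity along geodesics gives \<open>h k \<le> g k\<close>. The cap is strongly convex with constant cot R,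
  seen from any of its points in normal coordinates, so the Frank-Wolfe direction satisfies
  \<open>\<nu> * (norm v)\<^sup>2 \<le> 2 * tan R * g\<close>. The quadratic error of a step is therefore absorbed into
  the linear decrease, \<open>h (k + 1) \<le> h k - \<eta> * g k + (L * tan R / \<nu>) * \<eta>\<^sup>2 * g k\<close>,
  and with \<open>\<eta> = a / (k + a)\<close> the factors \<open>1 - \<eta> + (L * tan R / \<nu>) * \<eta>\<^sup>2\<close> multiply up to
  order \<open>k powr (-a)\<close>. The starting value at K comes from the crude bound \<open>norm v \<le> 2 * R\<close>,
  and the gap bound from telescoping the decrease over the second half of the iterations.
\<close>

section \<open>Open-loop recursions\<close>

text \<open>The step size at \<open>k = 0\<close> is 1, so \<open>h 0\<close> cancels and no initial
  value enters. From there on the bound \<open>C * a\<^sup>2 / s\<close> with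
  \<open>s = k + a\<close> reproduces itself.\<close>

lemma open_loop_sublinear:
  fixes h :: "nat \<Rightarrow> real"
  assumes a: "a \<ge> 2" and C: "C \<ge> 0"
    and descent: "\<And>k. h (Suc k) \<le> (1 - a / (real k + a)) * h k + C * (a / (real k + a))\<^sup>2"
  shows "h (Suc k) \<le> C * a\<^sup>2 / (real k + a)"
proof (induction k)
  case 0
  have "C \<le> C * a" using a C by (simp add: mult_le_cancel_left1)
  then show ?case using descent[of 0] a by (simp add: power2_eq_square)
next
  case (Suc k)
  define s where "s = real k + a"
  have s: "s > 0" "s \<ge> a" using a by (auto simp: s_def)
  have "h (Suc (Suc k)) \<le> (1 - a / (s + 1)) * h (Suc k) + C * (a / (s + 1))\<^sup>2"
    using descent[of "Suc k"] by (simp add: s_def algebra_simps)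
  also have "\<dots> \<le> (1 - a / (s + 1)) * (C * a\<^sup>2 / s) + C * (a / (s + 1))\<^sup>2"
    using Suc.IH s by (intro add_right_mono mult_left_mono) (auto simp: s_def field_simps)
  also have "\<dots> = C * a\<^sup>2 * ((s + 1 - a) / (s * (s + 1)) + 1 / (s + 1)\<^sup>2)"
    using s by (simp add: field_simps power2_eq_square)
  also have "\<dots> \<le> C * a\<^sup>2 * (1 / (s + 1))"
  proof (intro mult_left_mono)
    \<comment> \<open>Here \<open>a \<ge> 2\<close> gives \<open>s + 1 - a \<le> s - 1\<close>, just
      enough room for the error term.\<close>
    have "(s + 1 - a) / (s * (s + 1)) + 1 / (s + 1)\<^sup>2 \<le> (s - 1) / (s * (s + 1)) + 1 / (s * (s + 1))"
      using a s by (intro add_mono divide_right_mono divide_left_mono) (auto simp: power2_eq_square)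
    also have "\<dots> = 1 / (s + 1)" using s by (simp add: add_divide_distrib[symmetric])
    finally show "(s + 1 - a) / (s * (s + 1)) + 1 / (s + 1)\<^sup>2 \<le> 1 / (s + 1)" .
  qed (use C in auto)
  finally show ?case by (simp add: s_def algebra_simps)
qed

text \<open>Compares the step sizes \<open>a / s\<close> with increments of \<open>a * ln s\<close>;
  this yields the power law below and the constant \<open>ln (3 / 2)\<close>.\<close>

lemma ln_one_step:
  fixes s :: real
  assumes "s > 0"
  shows "ln (s + 1) - ln s \<le> 1 / s"
proof -
  have "ln (s + 1) - ln s = ln ((s + 1) / s)" using assms by (simp add: ln_div)
  also have "\<dots> \<le> (s + 1) / s - 1" using assms by (intro ln_le_minus_one) auto
  also have "\<dots> = 1 / s" using assms by (simp add: field_simps)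
  finally show ?thesis .
qed

text \<open>The bound on \<open>a * \<rho>\<close> makes the total coefficient of \<open>g k\<close>
  nonpositive from \<open>K\<close> on, so \<open>g k\<close> may be replaced by the smaller
  \<open>h k\<close>. The resulting factor \<open>1 - a / s + a\<^sup>2 * \<rho> / s\<^sup>2\<close>
  is at most its exponential; the first-order terms build up the power, the second-order terms a
  convergent sum.\<close>

lemma open_loop_contraction:
  fixes h g :: "nat \<Rightarrow> real"
  assumes a: "a \<ge> 2" and K: "K \<ge> 1" and rho: "\<rho> \<ge> 0" "a * \<rho> \<le> real K + a"
    and h0: "\<And>k. 0 \<le> h k" and gh: "\<And>k. h k \<le> g k"
    and descent: "\<And>k. h (Suc k) \<le> h k - a / (real k + a) * g k + \<rho> * (a / (real k + a))\<^sup>2 * g k"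
    and k: "k \<ge> K"
  shows "h k \<le> h K * exp (a\<^sup>2 * \<rho> / (real K + a - 1)) * ((real K + a) / (real k + a)) powr a"
proof -
  \<comment> \<open>The induction carries the telescoped sum of the second-order terms; its negative
    part is dropped only at the end.\<close>
  have main: "h k \<le> h K * exp (a\<^sup>2 * \<rho> * (1 / (real K + a - 1) - 1 / (real k + a - 1)))
      * ((real K + a) / (real k + a)) powr a"
    using k
  proof (induction k rule: dec_induct)
    case base
    show ?case using a by simp
  next
    case (step k)
    define s where "s = real k + a"
    have s: "s \<ge> 3" "s > 0" "a * \<rho> \<le> s" using a K step.hyps rho by (auto simp: s_def)
    have ar: "\<rho> * (a / s) \<le> 1" using s by (simp add: field_simps)
    have "h (Suc k) \<le> h k - (a / s) * (1 - \<rho> * (a / s)) * g k"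
      using descent[of k] by (simp add: s_def algebra_simps power2_eq_square)
    also have "\<dots> \<le> h k - (a / s) * (1 - \<rho> * (a / s)) * h k"
      using gh[of k] ar a s by (intro diff_left_mono mult_left_mono mult_nonneg_nonneg) auto
    also have "\<dots> = h k * (1 + (a\<^sup>2 * \<rho> / s\<^sup>2 - a / s))" by (simp add: algebra_simps power2_eq_square)
    also have "\<dots> \<le> h k * exp (a\<^sup>2 * \<rho> / s\<^sup>2 - a / s)"
      using h0 by (intro mult_left_mono exp_ge_add_one_self) auto
    also have "\<dots> \<le> h k * (exp (a\<^sup>2 * \<rho> * (1 / (s - 1) - 1 / s)) * (s / (s + 1)) powr a)"
    proof (intro mult_left_mono)
      \<comment> \<open>Makes the second-order terms telescope.\<close>
      have "1 / s\<^sup>2 \<le> 1 / (s * (s - 1))"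
        using s by (intro divide_left_mono) (auto simp: power2_eq_square)
      also have "\<dots> = 1 / (s - 1) - 1 / s" using s by (simp add: field_simps)
      finally have 1: "a\<^sup>2 * \<rho> * (1 / s\<^sup>2) \<le> a\<^sup>2 * \<rho> * (1 / (s - 1) - 1 / s)"
        using rho by (intro mult_left_mono) auto
      have "a * (ln (s + 1) - ln s) \<le> a * (1 / s)"
        using ln_one_step[of s] s a by (intro mult_left_mono) auto
      then have "a\<^sup>2 * \<rho> / s\<^sup>2 - a / s \<le> a\<^sup>2 * \<rho> * (1 / (s - 1) - 1 / s) + a * ln (s / (s + 1))"
        using 1 s by (simp add: ln_div right_diff_distrib)
      then have "exp (a\<^sup>2 * \<rho> / s\<^sup>2 - a / s)
          \<le> exp (a\<^sup>2 * \<rho> * (1 / (s - 1) - 1 / s) + a * ln (s / (s + 1)))" by simp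
      also have "\<dots> = exp (a\<^sup>2 * \<rho> * (1 / (s - 1) - 1 / s)) * (s / (s + 1)) powr a"
        using s by (simp add: exp_add powr_def)
      finally show "exp (a\<^sup>2 * \<rho> / s\<^sup>2 - a / s)
          \<le> exp (a\<^sup>2 * \<rho> * (1 / (s - 1) - 1 / s)) * (s / (s + 1)) powr a" .
    qed (use h0 in auto)
    also have "\<dots> \<le> h K * exp (a\<^sup>2 * \<rho> * (1 / (real K + a - 1) - 1 / (s - 1)))
      * ((real K + a) / s) powr a * (exp (a\<^sup>2 * \<rho> * (1 / (s - 1) - 1 / s)) * (s / (s + 1)) powr a)"
      using step.IH by (intro mult_right_mono) (auto simp: s_def)
    also have "\<dots> = h K * (exp (a\<^sup>2 * \<rho> * (1 / (real K + a - 1) - 1 / (s - 1)))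
        * exp (a\<^sup>2 * \<rho> * (1 / (s - 1) - 1 / s)))
        * (((real K + a) / s) powr a * (s / (s + 1)) powr a)" by (simp only: mult_ac)
    also have "\<dots> = h K * exp (a\<^sup>2 * \<rho> * (1 / (real K + a - 1) - 1 / s)) * ((real K + a) / (s + 1)) powr a"
      using s a by (simp add: exp_add[symmetric] powr_mult[symmetric] distrib_left[symmetric])
    finally show ?case by (simp add: s_def algebra_simps)
  qed
  have "1 / (real K + a - 1) - 1 / (real k + a - 1) \<le> 1 / (real K + a - 1)" using a by simp
  then have "a\<^sup>2 * \<rho> * (1 / (real K + a - 1) - 1 / (real k + a - 1)) \<le> a\<^sup>2 * \<rho> * (1 / (real K + a - 1))"
    using rho by (intro mult_left_mono) auto
  then have "h K * exp (a\<^sup>2 * \<rho> * (1 / (real K + a - 1) - 1 / (real k + a - 1))) * ((real K + a) / (real k + a)) powr a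
    \<le> h K * exp (a\<^sup>2 * \<rho> / (real K + a - 1)) * ((real K + a) / (real k + a)) powr a"
    using h0 by (intro mult_right_mono mult_left_mono) auto
  with main show ?thesis by linarith
qed

text \<open>Under the doubled threshold the quadratic error is at most half of the linear decrease,
  so every step from \<open>m\<close> to \<open>k\<close> lowers \<open>h\<close> by at least
  \<open>G * a / (2 * s)\<close>. These decreases add up to at most \<open>h m\<close>, because
  \<open>h k \<ge> 0\<close>.\<close>

lemma open_loop_gap:
  fixes h g :: "nat \<Rightarrow> real"
  assumes a: "a \<ge> 2" and m: "m = k div 2" and rho: "2 * a * \<rho> \<le> real m + a"
    and k: "real k \<ge> 2 * a"
    and h0: "\<And>k. 0 \<le> h k" and gh: "\<And>k. h k \<le> g k"
    and descent: "\<And>k. h (Suc k) \<le> h k - a / (real k + a) * g k + \<rho> * (a / (real k + a))\<^sup>2 * g k"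
    and G: "0 \<le> G" "\<And>j. m \<le> j \<Longrightarrow> j < k \<Longrightarrow> G \<le> g j"
  shows "G \<le> 2 * h m / (a * ln (3 / 2))"
proof -
  have half: "G * a / 2 * (ln (real j + a) - ln (real m + a)) \<le> h m - h j" if "m \<le> j" "j \<le> k" for j
    using that
  proof (induction j rule: dec_induct)
    case base
    show ?case by simp
  next
    case (step j)
    define s where "s = real j + a"
    have s: "s > 0" "2 * a * \<rho> \<le> s" using a step.hyps rho by (auto simp: s_def)
    have Gj: "G \<le> g j" using G step by simp
    have "\<rho> * (a / s) * (a / s * g j) \<le> 1 / 2 * (a / s * g j)"
      using s a Gj G by (intro mult_right_mono) (auto simp: field_simps)
    moreover have "\<rho> * (a / s)\<^sup>2 * g j = \<rho> * (a / s) * (a / s * g j)"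
      by (simp add: power2_eq_square)
    ultimately have "h (Suc j) \<le> h j - 1 / 2 * (a / s * g j)"
      using descent[of j] unfolding s_def[symmetric] by linarith
    moreover have "a / s * G \<le> a / s * g j" using Gj s a by (intro mult_left_mono) auto
    moreover have "G * a / 2 * (ln (s + 1) - ln s) \<le> G * a / 2 * (1 / s)"
      using ln_one_step[of s] s a G by (intro mult_left_mono) auto
    moreover have "G * a / 2 * (ln s - ln (real m + a)) \<le> h m - h j" using step by (simp add: s_def)
    ultimately have "G * a / 2 * (ln (s + 1) - ln (real m + a)) \<le> h m - h (Suc j)"
      by (simp add: algebra_simps)
    then show ?case by (simp add: s_def algebra_simps)
  qed
  have mk: "real m \<le> real k / 2" using m by linarith
  \<comment> \<open>With \<open>m \<le> k / 2\<close> this reduces to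
    \<open>a \<le> k / 2\<close>.\<close>
  have "3 * (real m + a) \<le> 2 * (real k + a)" using mk k by (simp add: algebra_simps)
  then have "3 / 2 \<le> (real k + a) / (real m + a)" using a by (simp add: field_simps)
  then have "ln (3 / 2) \<le> ln ((real k + a) / (real m + a))" by (intro ln_mono) auto
  then have "ln (3 / 2) \<le> ln (real k + a) - ln (real m + a)" using a by (simp add: ln_div)
  then have "G * a / 2 * ln (3 / 2) \<le> G * a / 2 * (ln (real k + a) - ln (real m + a))"
    using G a by (intro mult_left_mono) auto
  also have "\<dots> \<le> h m" using half[of k] h0[of k] m by simp
  finally have "G * (a * ln (3 / 2)) \<le> 2 * h m" by simp
  then show ?thesis using a by (simp add: pos_le_divide_eq)
qed

section \<open>Geometry of spherical caps\<close>

text \<open>Below \<open>pi / 2\<close> this is \<open>x \<le> tan x\<close> cleared of the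
  denominator; it is applied to half the length of a velocity.\<close>

lemma mult_cos_le_sin:
  fixes x :: real
  assumes "0 \<le> x" "x \<le> pi"
  shows "x * cos x \<le> sin x"
proof -
  have "sin 0 - 0 * cos 0 \<le> sin x - x * cos x"
  proof (rule DERIV_nonneg_imp_nondecreasing[OF assms(1)])
    fix y assume "0 \<le> y" "y \<le> x"
    then have "((\<lambda>x. sin x - x * cos x) has_real_derivative y * sin y) (at y)" "0 \<le> y * sin y"
      using assms by (auto intro!: derivative_eq_intros sin_ge_zero mult_nonneg_nonneg)
    then show "\<exists>D. ((\<lambda>x. sin x - x * cos x) has_real_derivative D) (at y) \<and> 0 \<le> D" by blast
  qed
  then show ?thesis by simp
qed

text \<open>Since cos decreases on \<open>{0..pi}\<close>, a geodesic ball is the sphere cut by a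
  half-space; all later geometry uses this linear constraint.\<close>

lemma sphere_cball_eq:
  fixes p :: "'a::euclidean_space"
  assumes "DIM('a) \<ge> 2" "p \<in> sphere 0 1" "0 \<le> R" "R \<le> pi"
  shows "sphere_cball p R = {x \<in> sphere 0 1. cos R \<le> x \<bullet> p}"
proof -
  have "sphere_dist x p \<le> R \<longleftrightarrow> cos R \<le> x \<bullet> p" if "x \<in> sphere 0 1" for x
  proof -
    have "\<bar>x \<bullet> p\<bar> \<le> 1" using Cauchy_Schwarz_ineq2[of x p] that assms(2) by simp
    then have b: "-1 \<le> x \<bullet> p" "x \<bullet> p \<le> 1" by auto
    have "arccos (x \<bullet> p) \<le> R \<longleftrightarrow> cos R \<le> cos (arccos (x \<bullet> p))"
      using b assms by (subst cos_mono_le_eq) (auto intro: arccos_lbound arccos_ubound)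
    then show ?thesis using b that assms by (simp add: sphere_dist_eq_arccos)
  qed
  then show ?thesis by (auto simp: sphere_cball_def)
qed

text \<open>With a unit direction the quotient \<open>sin (norm v) / norm v\<close> disappears; cos
  is even and sin odd, so the sign of \<open>r\<close> is arbitrary.\<close>

lemma sphere_exp_scaleR:
  fixes x w :: "'a::euclidean_space"
  assumes "x \<in> sphere 0 1" "w \<in> tangent_space x" "norm w = 1"
  shows "sphere_exp x (r *\<^sub>R w) = cos r *\<^sub>R x + sin r *\<^sub>R w"
proof -
  have "r *\<^sub>R w \<in> tangent_space x" using assms by (simp add: tangent_space_def)
  then show ?thesis using assms by (cases "r \<ge> 0") (auto simp: sphere_exp_eq)
qed

lemma sphere_exp_in_sphere:
  fixes x w :: "'a::euclidean_space"
  assumes "x \<in> sphere 0 1" "w \<in> tangent_space x" "norm w = 1"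
  shows "sphere_exp x (r *\<^sub>R w) \<in> sphere 0 1"
proof -
  have "x \<bullet> x = 1" "w \<bullet> w = 1" "x \<bullet> w = 0" "w \<bullet> x = 0"
    using assms by (auto simp: dot_square_norm tangent_space_def inner_commute)
  then have "sphere_exp x (r *\<^sub>R w) \<bullet> sphere_exp x (r *\<^sub>R w) = (cos r)\<^sup>2 + (sin r)\<^sup>2"
    unfolding sphere_exp_scaleR[OF assms] by (simp add: inner_simps power2_eq_square)
  then show ?thesis by (simp add: norm_eq_1)
qed

lemma unit_tangent_exists:
  fixes x :: "'a::euclidean_space"
  assumes "DIM('a) \<ge> 2"
  obtains w where "w \<in> tangent_space x" "norm w = 1"
proof -
  obtain w where w: "w \<noteq> 0" "orthogonal x w" using orthogonal_to_vector_exists[OF assms] by blast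
  show ?thesis
    by (rule that[of "(1 / norm w) *\<^sub>R w"]) (use w in \<open>auto simp: tangent_space_def orthogonal_def\<close>)
qed

text \<open>For \<open>v = 0\<close> any unit tangent vector serves; its existence uses
  \<open>DIM('a) \<ge> 2\<close>.\<close>

lemma tangent_polar:
  fixes x :: "'a::euclidean_space"
  assumes "DIM('a) \<ge> 2" "v \<in> tangent_space x"
  obtains w where "w \<in> tangent_space x" "norm w = 1" "v = norm v *\<^sub>R w"
proof (cases "v = 0")
  case True
  then show ?thesis using unit_tangent_exists[OF assms(1), of x] that by auto
next
  case False
  show ?thesis
    by (rule that[of "(1 / norm v) *\<^sub>R v"]) (use assms False in \<open>auto simp: tangent_space_def\<close>)
qed

text \<open>The part of \<open>y\<close> orthogonal to \<open>x\<close> has length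
  \<open>sin (arccos (x \<bullet> y))\<close>. If it vanishes, the direction is arbitrary.\<close>

lemma sphere_polar:
  fixes x y :: "'a::euclidean_space"
  assumes "DIM('a) \<ge> 2" "x \<in> sphere 0 1" "y \<in> sphere 0 1"
  obtains w where "w \<in> tangent_space x" "norm w = 1"
    "y = cos (arccos (x \<bullet> y)) *\<^sub>R x + sin (arccos (x \<bullet> y)) *\<^sub>R w"
proof -
  have xx: "x \<bullet> x = 1" "y \<bullet> y = 1" using assms by (auto simp: dot_square_norm)
  have "\<bar>x \<bullet> y\<bar> \<le> 1" using Cauchy_Schwarz_ineq2[of x y] assms by simp
  then have b: "-1 \<le> x \<bullet> y" "x \<bullet> y \<le> 1" by auto
  define q where "q = y - (x \<bullet> y) *\<^sub>R x"
  have q: "q \<in> tangent_space x" by (simp add: q_def tangent_space_def inner_simps xx)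
  obtain w where w: "w \<in> tangent_space x" "norm w = 1" "q = norm q *\<^sub>R w"
    using tangent_polar[OF assms(1) q] .
  have "norm q = sqrt (1 - (x \<bullet> y)\<^sup>2)"
    by (simp add: norm_eq_sqrt_inner q_def inner_simps xx inner_commute power2_eq_square)
  then have "norm q = sin (arccos (x \<bullet> y))" using b by (simp add: sin_arccos)
  then have "y = cos (arccos (x \<bullet> y)) *\<^sub>R x + sin (arccos (x \<bullet> y)) *\<^sub>R w"
    using w(3) b unfolding q_def by (simp add: algebra_simps)
  with w show ?thesis using that by blast
qed

section \<open>Caps inside an open hemisphere: convexity, feasible velocities, optimal
  directions\<close>

locale spherical_cap =
  fixes p :: "'a::euclidean_space" and R :: real and X :: "'a set"
  assumes dim: "DIM('a) \<ge> 2" and p: "p \<in> sphere 0 1" and R: "0 < R" "R < pi / 2"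
    and X: "X = sphere_cball p R"
begin

lemma X_iff: "x \<in> X \<longleftrightarrow> x \<in> sphere 0 1 \<and> cos R \<le> x \<bullet> p"
  using sphere_cball_eq[OF dim p, of R] R by (simp add: X)

lemma cosR_pos: "cos R > 0" using R by (intro cos_gt_zero) auto

lemma sinR_pos: "sin R > 0" using R by (intro sin_gt_zero) auto

text \<open>A triangle inequality through the centre: the components orthogonal to \<open>p\<close>
  have length at most \<open>sin R\<close>, so \<open>x \<bullet> y \<ge> (cos R)\<^sup>2 - (sin
  R)\<^sup>2 = cos (2 * R)\<close>.\<close>

lemma angle_le:
  assumes "x \<in> X" "y \<in> X"
  shows "arccos (x \<bullet> y) \<le> 2 * R"
proof -
  have n: "norm x = 1" "norm y = 1" "norm p = 1" using assms p by (auto simp: X_iff)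
  have ub: "\<bar>x \<bullet> p\<bar> \<le> 1" "\<bar>y \<bullet> p\<bar> \<le> 1" "\<bar>x \<bullet> y\<bar> \<le> 1"
    using Cauchy_Schwarz_ineq2[of x p] Cauchy_Schwarz_ineq2[of y p] Cauchy_Schwarz_ineq2[of x y] n by auto
  have u: "u \<bullet> u = 1" if "norm u = 1" for u :: 'a using that by (simp add: norm_eq_1)
  let ?qx = "x - (x \<bullet> p) *\<^sub>R p" and ?qy = "y - (y \<bullet> p) *\<^sub>R p"
  have q: "norm (z - (z \<bullet> p) *\<^sub>R p) \<le> sin R" if "norm z = 1" "cos R \<le> z \<bullet> p" for z
  proof -
    have "norm (z - (z \<bullet> p) *\<^sub>R p) ^ 2 = 1 - (z \<bullet> p)\<^sup>2"
      unfolding power2_norm_eq_inner using u[OF that(1)] u[OF n(3)]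
      by (simp add: inner_simps inner_commute power2_eq_square)
    also have "\<dots> \<le> 1 - (cos R)\<^sup>2" using that cosR_pos by (simp add: power_mono)
    also have "\<dots> = (sin R)\<^sup>2" by (simp add: sin_squared_eq)
    finally show ?thesis by (rule power2_le_imp_le) (use sinR_pos in simp)
  qed
  have "\<bar>?qx \<bullet> ?qy\<bar> \<le> norm ?qx * norm ?qy" by (rule Cauchy_Schwarz_ineq2)
  also have "\<dots> \<le> sin R * sin R" using q assms n sinR_pos by (intro mult_mono) (auto simp: X_iff)
  finally have "- (sin R * sin R) \<le> ?qx \<bullet> ?qy" by simp
  moreover have "?qx \<bullet> ?qy = x \<bullet> y - (x \<bullet> p) * (y \<bullet> p)"
    by (simp add: inner_simps u n inner_commute)
  moreover have "cos R * cos R \<le> (x \<bullet> p) * (y \<bullet> p)"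
    using assms cosR_pos by (intro mult_mono) (auto simp: X_iff)
  ultimately have "cos (2 * R) \<le> x \<bullet> y" by (simp add: cos_double power2_eq_square)
  then have "cos (2 * R) \<le> cos (arccos (x \<bullet> y))" using ub by simp
  then show ?thesis
    using R ub by (subst (asm) cos_mono_le_eq) (auto intro!: arccos_lbound arccos_ubound)
qed

text \<open>Along the geodesic, \<open>sin r\<close> times the inner product with \<open>p\<close>
  is the combination of its end values with weights \<open>sin (r - \<theta>)\<close> and
  \<open>sin \<theta>\<close>. The weights add up to at least \<open>sin r\<close>, and the end
  values are at least the positive number \<open>cos R\<close>.\<close>

lemma X_geodesically_convex:
  assumes x: "x \<in> X" and w: "w \<in> tangent_space x" "norm w = 1"
    and r: "0 \<le> r" "r < pi" and y: "sphere_exp x (r *\<^sub>R w) \<in> X" and \<theta>: "0 \<le> \<theta>" "\<theta> \<le> r"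
  shows "sphere_exp x (\<theta> *\<^sub>R w) \<in> X"
proof (cases "r = 0")
  case True
  then show ?thesis using y \<theta> by simp
next
  case False
  have xs: "x \<in> sphere 0 1" using x by (simp add: X_iff)
  define s b where "s = x \<bullet> p" and "b = w \<bullet> p"
  have sr: "sin r > 0" using r False by (intro sin_gt_zero) auto
  have sb: "cos R \<le> s" "cos R \<le> cos r * s + sin r * b"
    using x y by (auto simp: X_iff s_def b_def sphere_exp_scaleR[OF xs w] inner_simps)
  \<comment> \<open>The sum of the weights is
    \<open>2 * sin (r / 2) * cos (r / 2 - \<theta>)\<close>, smallest when \<theta> is 0 or
    r.\<close>
  have "\<bar>r / 2 - \<theta>\<bar> \<le> r / 2" using \<theta> by (simp add: abs_if)
  then have "cos (r / 2) \<le> cos \<bar>r / 2 - \<theta>\<bar>" using r by (intro cos_monotone_0_pi_le) auto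
  then have "2 * sin (r / 2) * cos (r / 2) \<le> 2 * sin (r / 2) * cos (r / 2 - \<theta>)"
    using r by (intro mult_left_mono) (auto intro: sin_ge_zero)
  moreover have "2 * sin (r / 2) * cos (r / 2) = sin r" using sin_double[of "r / 2"] by simp
  moreover have "2 * sin (r / 2) * cos (r / 2 - \<theta>) = sin (r - \<theta>) + sin \<theta>"
    using sin_plus_sin[of "r - \<theta>" \<theta>] by (simp add: field_simps)
  ultimately have c: "sin r \<le> sin (r - \<theta>) + sin \<theta>" by simp
  have nn: "0 \<le> sin (r - \<theta>)" "0 \<le> sin \<theta>" using r \<theta> by (auto intro!: sin_ge_zero)
  have "sin r * cos R \<le> (sin (r - \<theta>) + sin \<theta>) * cos R" using c cosR_pos by (intro mult_right_mono) auto
  also have "\<dots> \<le> sin (r - \<theta>) * s + sin \<theta> * (cos r * s + sin r * b)"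
    unfolding distrib_right using sb nn by (intro add_mono mult_left_mono) auto
  also have "\<dots> = sin r * (cos \<theta> * s + sin \<theta> * b)" by (simp add: sin_diff algebra_simps)
  finally have "cos R \<le> cos \<theta> * s + sin \<theta> * b" using sr by simp
  then show ?thesis
    using sphere_exp_in_sphere[OF xs w] by (simp add: X_iff s_def b_def sphere_exp_scaleR[OF xs w] inner_simps)
qed

text \<open>Below length \<open>pi\<close>, arccos inverts cos, so the geodesic is minimizing;
  convexity keeps it in \<open>X\<close>. Only the endpoint has to be checked.\<close>

lemma feasible_velocitiesI:
  assumes x: "x \<in> X" and w: "w \<in> tangent_space x" "norm w = 1"
    and r: "0 \<le> r" "r < pi" and y: "sphere_exp x (r *\<^sub>R w) \<in> X"
  shows "r *\<^sub>R w \<in> feasible_velocities X x"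
proof -
  have xs: "x \<in> sphere 0 1" using x by (simp add: X_iff)
  have xw: "x \<bullet> w = 0" "x \<bullet> x = 1" using w xs by (auto simp: tangent_space_def norm_eq_1)
  have "sphere_dist x (sphere_exp x (r *\<^sub>R w)) = arccos (cos r)"
    using sphere_dist_eq_arccos[OF dim xs sphere_exp_in_sphere[OF xs w]]
    by (simp add: sphere_exp_scaleR[OF xs w] inner_simps xw)
  then have "sphere_dist x (sphere_exp x (r *\<^sub>R w)) = norm (r *\<^sub>R w)" using r w by (simp add: arccos_cos)
  moreover have "sphere_exp x (t *\<^sub>R (r *\<^sub>R w)) \<in> X" if "t \<in> {0..1}" for t
    using X_geodesically_convex[OF x w r y, of "t * r"] that r by (simp add: mult_left_le_one_le)
  moreover have "r *\<^sub>R w \<in> tangent_space x" using w by (simp add: tangent_space_def)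
  ultimately show ?thesis using y by (simp add: feasible_velocities_def)
qed

lemma feasible_velocity_norm:
  assumes x: "x \<in> X" and v: "v \<in> feasible_velocities X x"
  shows "norm v \<le> 2 * R"
proof -
  have y: "sphere_exp x v \<in> X" "norm v = sphere_dist x (sphere_exp x v)"
    using v by (auto simp: feasible_velocities_def)
  then have "norm v = arccos (x \<bullet> sphere_exp x v)"
    using sphere_dist_eq_arccos[OF dim] x y(1) by (auto simp: X_iff)
  then show ?thesis using angle_le[OF x y(1)] by simp
qed

text \<open>Polar coordinates exhibit the set as a continuous image of a compact one, from which the
  existence of a Frank-Wolfe direction follows. The bound \<open>2 * R < pi\<close> makes every
  listed pair feasible.\<close>

lemma feasible_velocities_eq:
  assumes x: "x \<in> X"
  shows "feasible_velocities X x = (\<lambda>(r, w). r *\<^sub>R w) `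
    {(r, w). r \<in> {0..2 * R} \<and> w \<in> sphere 0 1 \<and> x \<bullet> w = 0 \<and> cos R \<le> cos r * (x \<bullet> p) + sin r * (w \<bullet> p)}"
    (is "_ = ?m ` ?A")
proof (intro equalityI subsetI)
  have xs: "x \<in> sphere 0 1" using x by (simp add: X_iff)
  fix v
  {
    assume v: "v \<in> feasible_velocities X x"
    then have "v \<in> tangent_space x" by (simp add: feasible_velocities_def)
    then obtain w where w: "w \<in> tangent_space x" "norm w = 1" "v = norm v *\<^sub>R w"
      using tangent_polar[OF dim] by metis
    have "sphere_exp x (norm v *\<^sub>R w) \<in> X" using v w by (simp add: feasible_velocities_def)
    then have "cos R \<le> cos (norm v) * (x \<bullet> p) + sin (norm v) * (w \<bullet> p)"
      by (simp add: X_iff sphere_exp_scaleR[OF xs w(1,2)] inner_simps)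
    then have "(norm v, w) \<in> ?A"
      using w feasible_velocity_norm[OF x v] by (auto simp: tangent_space_def)
    moreover have "v = ?m (norm v, w)" using w by simp
    ultimately show "v \<in> ?m ` ?A" by blast
  next
    assume "v \<in> ?m ` ?A"
    then obtain r w where rw: "v = r *\<^sub>R w" "0 \<le> r" "r \<le> 2 * R" "w \<in> tangent_space x" "norm w = 1"
      "cos R \<le> cos r * (x \<bullet> p) + sin r * (w \<bullet> p)" by (auto simp: tangent_space_def)
    then have "sphere_exp x (r *\<^sub>R w) \<in> X"
      using sphere_exp_in_sphere[OF xs rw(4,5)]
      by (simp add: X_iff sphere_exp_scaleR[OF xs rw(4,5)] inner_simps)
    then show "v \<in> feasible_velocities X x"
      using feasible_velocitiesI[OF x rw(4,5)] rw R by simp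
  }
qed

lemma compact_feasible_velocities:
  assumes x: "x \<in> X"
  shows "compact (feasible_velocities X x)"
proof -
  let ?A = "{(r, w). r \<in> {0..2 * R} \<and> w \<in> sphere 0 1 \<and> x \<bullet> w = 0 \<and>
    cos R \<le> cos r * (x \<bullet> p) + sin r * (w \<bullet> p)}"
  have "?A = ({0..2 * R} \<times> sphere 0 1) \<inter> {z. x \<bullet> snd z = 0 \<and>
      cos R \<le> cos (fst z) * (x \<bullet> p) + sin (fst z) * (snd z \<bullet> p)}"
    by auto
  moreover have "closed {z::real \<times> 'a. x \<bullet> snd z = 0 \<and>
      cos R \<le> cos (fst z) * (x \<bullet> p) + sin (fst z) * (snd z \<bullet> p)}"
    by (intro closed_Collect_conj closed_Collect_eq closed_Collect_le continuous_intros)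
  ultimately have "compact ?A" by (simp add: compact_Times compact_Int_closed)
  then show ?thesis unfolding feasible_velocities_eq[OF x]
    by (intro compact_continuous_image) (auto simp: case_prod_unfold intro!: continuous_intros)
qed

lemma zero_feasible_velocity: "x \<in> X \<Longrightarrow> 0 \<in> feasible_velocities X x"
  using unit_tangent_exists[OF dim, of x] feasible_velocitiesI[of x _ 0] sphere_exp_scaleR[of x _ 0]
  by (metis X_iff cos_zero pi_gt_zero scaleR_one scaleR_zero_left sin_zero add.right_neutral order_refl)

lemma fw_argmin_nonempty:
  assumes "x \<in> X"
  shows "fw_argmin X f x \<noteq> {}"
proof -
  have "feasible_velocities X x \<noteq> {}" using zero_feasible_velocity[OF assms] by blast
  then obtain v where "v \<in> feasible_velocities X x"
    "\<forall>u \<in> feasible_velocities X x. sphere_grad f x \<bullet> v \<le> sphere_grad f x \<bullet> u"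
    using continuous_attains_inf[OF compact_feasible_velocities[OF assms], of "\<lambda>v. sphere_grad f x \<bullet> v"]
      continuous_on_inner[OF continuous_on_const continuous_on_id] by metis
  then have "v \<in> fw_argmin X f x" by (fastforce simp: fw_argmin_def is_arg_min_def)
  then show ?thesis by blast
qed

text \<open>Provides a Riemannian logarithm of \<open>y\<close> at \<open>x\<close> as a competitor
  for the Frank-Wolfe direction; \<open>angle_le\<close> keeps its length below
  \<open>pi\<close>.\<close>

lemma log_exists:
  assumes x: "x \<in> X" and y: "y \<in> X"
  obtains r w where "w \<in> tangent_space x" "norm w = 1" "r *\<^sub>R w \<in> feasible_velocities X x"
    "sphere_exp x (r *\<^sub>R w) = y"
proof -
  have xs: "x \<in> sphere 0 1" and ys: "y \<in> sphere 0 1" using x y by (auto simp: X_iff)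
  obtain w where w: "w \<in> tangent_space x" "norm w = 1"
    "y = cos (arccos (x \<bullet> y)) *\<^sub>R x + sin (arccos (x \<bullet> y)) *\<^sub>R w"
    using sphere_polar[OF dim xs ys] .
  have e: "sphere_exp x (arccos (x \<bullet> y) *\<^sub>R w) = y"
    using w(3) by (simp add: sphere_exp_scaleR[OF xs w(1,2)])
  have "\<bar>x \<bullet> y\<bar> \<le> 1" using Cauchy_Schwarz_ineq2[of x y] xs ys by simp
  then have 0: "0 \<le> arccos (x \<bullet> y)" by (intro arccos_lbound) auto
  show ?thesis
    by (rule that[OF w(1,2) feasible_velocitiesI[OF x w(1,2) 0] e])
       (use angle_le[OF x y] R y e in auto)
qed

text \<open>Phrased in the vector itself rather than in polar coordinates, so that it applies to
  perturbations \<open>v + t *\<^sub>R e\<close>.\<close>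

lemma feasible_velocities_memI:
  assumes x: "x \<in> X" and v: "v \<in> tangent_space x" "norm v < pi"
    and le: "cos R \<le> cos (norm v) * (x \<bullet> p) + sin (norm v) / norm v * (v \<bullet> p)"
  shows "v \<in> feasible_velocities X x"
proof -
  have xs: "x \<in> sphere 0 1" using x by (simp add: X_iff)
  obtain w where w: "w \<in> tangent_space x" "norm w = 1" "v = norm v *\<^sub>R w"
    using tangent_polar[OF dim v(1)] .
  have "sphere_exp x (norm v *\<^sub>R w) \<in> X"
    using sphere_exp_in_sphere[OF xs w(1,2), of "norm v"] sphere_exp_eq[OF xs v(1)] le w(3)
    by (simp add: X_iff inner_simps)
  then show ?thesis using feasible_velocitiesI[OF x w(1,2), of "norm v"] v w(3) by simp
qed

text \<open>
  In normal coordinates at x, X is the superlevel set \<^prop>\<open>\<phi> v \<ge> cos R\<close> with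
  \<^term>\<open>\<phi> v = cos (norm v) * (x \<bullet> p) + sin (norm v) / norm v * (v \<bullet> p)\<close>. On its boundary the
  radial derivative of \<open>\<phi>\<close> is -D with \<open>D \<ge> cos R * tan (r / 2)\<close>, whereas its gradient has norm
  at most sin R. Hence u - b v points into X as soon as \<open>b * r * D > sin R\<close>, and optimality of v
  gives \<open>u \<bullet> v \<ge> 1 / b\<close>.
\<close>

lemma maximal_velocity_scaling:
  assumes x: "x \<in> X" and v: "v \<in> feasible_velocities X x"
    and u: "u \<in> tangent_space x" "norm u = 1"
    and opt: "\<And>z. z \<in> feasible_velocities X x \<Longrightarrow> u \<bullet> z \<le> u \<bullet> v"
  shows "(norm v)\<^sup>2 \<le> 2 * tan R * (u \<bullet> v)"
proof (cases "v = 0")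
  case True
  then show ?thesis by simp
next
  case False
  define r where "r = norm v"
  have r: "0 < r" "r \<le> 2 * R" "r < pi" using False feasible_velocity_norm[OF x v] R by (auto simp: r_def)
  have vt: "v \<in> tangent_space x" using v by (simp add: feasible_velocities_def)
  then obtain w where w: "w \<in> tangent_space x" "norm w = 1" "v = r *\<^sub>R w"
    using tangent_polar[OF dim] unfolding r_def by metis
  have xs: "x \<in> sphere 0 1" using x by (simp add: X_iff)
  have ip: "x \<bullet> x = 1" "w \<bullet> w = 1" "u \<bullet> u = 1" "p \<bullet> p = 1" "x \<bullet> w = 0" "w \<bullet> x = 0" "x \<bullet> u = 0" "u \<bullet> x = 0"
    using w u xs p by (auto simp: norm_eq_1 tangent_space_def inner_commute)
  define s b D where "s = x \<bullet> p" and "b = w \<bullet> p" and "D = s * sin r - b * cos r"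
  have vp: "v \<bullet> p = r * b" by (simp add: w(3) b_def)
  define \<psi> where "\<psi> e t = cos (norm (v + t *\<^sub>R e)) * s
    + sin (norm (v + t *\<^sub>R e)) / norm (v + t *\<^sub>R e) * ((v + t *\<^sub>R e) \<bullet> p)" for e and t :: real
  have psi0: "\<psi> e 0 = cos r * s + sin r * b" for e
    using r by (simp add: \<psi>_def r_def[symmetric] vp)
  \<comment> \<open>The radial component of \<open>e\<close> contributes the factor
    \<open>-D\<close>; the component orthogonal to \<open>w\<close> is scaled by
    \<open>sin r / r\<close>.\<close>
  have dpsi: "(\<psi> e has_real_derivative (sin r / r * (e \<bullet> p - (w \<bullet> e) * b) - (w \<bullet> e) * D)) (at 0)" for e
  proof -
    have "((\<lambda>t. norm (v + t *\<^sub>R e)) has_derivative (\<lambda>t. t * (w \<bullet> e))) (at 0)"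
    proof -
      have "((\<lambda>t. v + t *\<^sub>R e) has_derivative (\<lambda>t. t *\<^sub>R e)) (at 0)"
        by (auto intro!: derivative_eq_intros)
      moreover have "(norm has_derivative (\<lambda>h. h \<bullet> sgn v)) (at (v + 0 *\<^sub>R e))"
        using has_derivative_norm[OF False] by simp
      ultimately have "((\<lambda>t. norm (v + t *\<^sub>R e)) has_derivative (\<lambda>t. t *\<^sub>R e \<bullet> sgn v)) (at 0)"
        by (rule has_derivative_compose)
      moreover have "sgn v = w" using r w by (simp add: sgn_div_norm)
      ultimately show ?thesis by (simp add: inner_commute)
    qed
    then have N: "((\<lambda>t. norm (v + t *\<^sub>R e)) has_real_derivative (w \<bullet> e)) (at 0)"
      by (rule has_derivative_imp_has_field_derivative) simp
    have M: "((\<lambda>t. (v + t *\<^sub>R e) \<bullet> p) has_real_derivative (e \<bullet> p)) (at 0)"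
    proof -
      have "(\<lambda>t. (v + t *\<^sub>R e) \<bullet> p) = (\<lambda>t. v \<bullet> p + t * (e \<bullet> p))" by (simp add: inner_simps)
      then show ?thesis by (auto intro!: derivative_eq_intros)
    qed
    have "(\<psi> e has_real_derivative - sin r * (w \<bullet> e) * s
        + (cos r * (w \<bullet> e) * r - sin r * (w \<bullet> e)) / (r * r) * (r * b) + sin r / r * (e \<bullet> p)) (at 0)"
      unfolding \<psi>_def[abs_def]
      by (rule derivative_eq_intros N M refl)+
        (use r M in \<open>auto simp: r_def[symmetric] vp\<close>)
    then show ?thesis by (rule DERIV_cong) (use r in \<open>simp add: D_def field_simps\<close>)
  qed
  \<comment> \<open>If a small move along the tangent vector \<open>e\<close> keeps \<open>v\<close>
    feasible, optimality of \<open>v\<close> forbids a gain in direction \<open>u\<close>.\<close>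
  have dir: "u \<bullet> e \<le> 0" if e: "x \<bullet> e = 0" and ev: "eventually (\<lambda>t. cos R \<le> \<psi> e t) (at_right 0)" for e
  proof -
    have "((\<lambda>t. norm (v + t *\<^sub>R e)) \<longlongrightarrow> norm (v + 0 *\<^sub>R e)) (at_right 0)"
      by (intro tendsto_intros)
    then have "eventually (\<lambda>t. norm (v + t *\<^sub>R e) < pi) (at_right 0)"
      using r by (intro order_tendstoD(2)) (auto simp: r_def)
    with ev have "eventually (\<lambda>t::real. t > 0 \<and> norm (v + t *\<^sub>R e) < pi \<and> cos R \<le> \<psi> e t) (at_right 0)"
      by (auto intro: eventually_elim2 eventually_conj eventually_at_right_less)
    then obtain t where t: "t > 0" "norm (v + t *\<^sub>R e) < pi" "cos R \<le> \<psi> e t"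
      using eventually_happens'[OF trivial_limit_at_right_real] by blast
    have "v + t *\<^sub>R e \<in> feasible_velocities X x"
      using t vt e by (intro feasible_velocities_memI[OF x]) (auto simp: tangent_space_def inner_simps \<psi>_def s_def)
    from opt[OF this] t show ?thesis by (simp add: inner_simps mult_le_0_iff)
  qed
  have "sphere_exp x v \<in> X" using v by (simp add: feasible_velocities_def)
  then have ge: "cos R \<le> cos r * s + sin r * b"
    by (simp add: w(3) sphere_exp_scaleR[OF xs w(1,2)] X_iff inner_simps s_def b_def)
  \<comment> \<open>Otherwise \<open>v\<close> could be moved along \<open>u\<close> itself,
    contradicting \<open>u \<bullet> u = 1\<close>.\<close>
  have act: "cos r * s + sin r * b = cos R"
  proof (rule ccontr)
    assume "\<not> ?thesis"
    then have "cos R < \<psi> u 0" using ge psi0 by simp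
    moreover have "(\<psi> u \<longlongrightarrow> \<psi> u 0) (at_right 0)"
      using DERIV_isCont[OF dpsi[of u]] by (auto simp: isCont_def intro: tendsto_within_subset)
    ultimately have "eventually (\<lambda>t. cos R < \<psi> u t) (at_right 0)" by (intro order_tendstoD(1))
    then have "u \<bullet> u \<le> 0" using ip by (intro dir) (auto elim: eventually_mono)
    then show False using ip by simp
  qed
  have sr: "sin r > 0" using r by (intro sin_gt_zero) auto
  have "D * sin r = s * ((sin r)\<^sup>2 + (cos r)\<^sup>2) - (cos r * s + sin r * b) * cos r"
    unfolding D_def by (simp add: algebra_simps power2_eq_square
      del: sin_cos_squared_add sin_cos_squared_add2 sin_cos_squared_add3)
  then have Ds: "D * sin r = s - cos R * cos r" by (simp add: act)
  \<comment> \<open>This is \<open>r / 2 \<le> tan (r / 2)\<close> in double-angle form; together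
    with \<open>s \<ge> cos R\<close> it bounds \<open>D\<close> from below.\<close>
  have "r / 2 * sin r \<le> 1 - cos r"
  proof -
    have h: "0 < r / 2" "r / 2 < pi / 2" using r by auto
    have "r / 2 * cos (r / 2) \<le> sin (r / 2)" using mult_cos_le_sin[of "r / 2"] h by simp
    then have "2 * sin (r / 2) * (r / 2 * cos (r / 2)) \<le> 2 * sin (r / 2) * sin (r / 2)"
      using h by (intro mult_left_mono) (auto intro: sin_ge_zero)
    then show ?thesis
      using sin_double[of "r / 2"] cos_double_sin[of "r / 2"] by (simp add: power2_eq_square mult_ac)
  qed
  then have "cos R * (r / 2 * sin r) \<le> cos R * (1 - cos r)" using cosR_pos by (intro mult_left_mono) auto
  also have "\<dots> \<le> s - cos R * cos r" using x by (simp add: X_iff s_def right_diff_distrib)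
  finally have "cos R * (r / 2) * sin r \<le> D * sin r" by (simp add: Ds)
  then have D: "cos R * (r / 2) \<le> D" using sr by simp
  have Dp: "D > 0" using D cosR_pos r by (smt (verit) divide_pos_pos mult_pos_pos)
  define q where "q = p - s *\<^sub>R x - b *\<^sub>R w"
  have qq: "q \<bullet> q = 1 - s\<^sup>2 - b\<^sup>2" and qw: "q \<bullet> w = 0"
    by (auto simp: q_def s_def b_def inner_simps ip inner_commute power2_eq_square)
  \<comment> \<open>The gradient of the constraint function at \<open>v\<close> within the tangent
    space. Since \<open>sin r \<le> r\<close>, and since the active constraint gives
    \<open>D\<^sup>2 = s\<^sup>2 + b\<^sup>2 - (cos R)\<^sup>2\<close>, its squared norm is at most
    \<open>(sin R)\<^sup>2\<close>.\<close>
  define z where "z = (sin r / r) *\<^sub>R q - D *\<^sub>R w"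
  have "z \<bullet> z = (sin r / r)\<^sup>2 * (q \<bullet> q) + D\<^sup>2"
    using qw by (simp add: z_def inner_simps ip inner_commute power2_eq_square)
  also have "\<dots> \<le> 1 * (q \<bullet> q) + D\<^sup>2"
    using sr r sin_x_le_x[of r] by (intro add_right_mono mult_right_mono) (auto simp: power_le_one)
  also have "D\<^sup>2 = (s\<^sup>2 + b\<^sup>2) * ((sin r)\<^sup>2 + (cos r)\<^sup>2) - (cos r * s + sin r * b)\<^sup>2"
    unfolding D_def by (simp add: algebra_simps power2_eq_square
      del: sin_cos_squared_add sin_cos_squared_add2 sin_cos_squared_add3)
  also have "1 * (q \<bullet> q) + ((s\<^sup>2 + b\<^sup>2) * ((sin r)\<^sup>2 + (cos r)\<^sup>2) - (cos r * s + sin r * b)\<^sup>2) = (sin R)\<^sup>2"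
    by (simp add: qq act sin_squared_eq)
  finally have "(norm z)\<^sup>2 \<le> (sin R)\<^sup>2" by (simp add: power2_norm_eq_inner)
  then have "norm z \<le> sin R" by (rule power2_le_imp_le) (use sinR_pos in simp)
  then have uz: "- sin R \<le> u \<bullet> z" using Cauchy_Schwarz_ineq2[of u z] u(2) by simp
  have "r * D \<le> sin R * (u \<bullet> v) + \<epsilon>" if eps: "\<epsilon> > 0" for \<epsilon>
  proof -
    \<comment> \<open>Chosen so that the constraint function has derivative at least
      \<open>\<epsilon> / r\<close> along \<open>u - \<beta> *\<^sub>R v\<close>: strict positivity
      is needed to enter \<open>X\<close>, and \<epsilon> is removed afterwards.\<close>
    define \<beta> where "\<beta> = (sin R + \<epsilon> / r) / (r * D)"
    define e where "e = u - \<beta> *\<^sub>R v"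
    have "sin r / r * (e \<bullet> p - (w \<bullet> e) * b) - (w \<bullet> e) * D = \<beta> * (r * D) + u \<bullet> z"
      by (simp add: e_def z_def q_def w(3) inner_simps ip b_def[symmetric] inner_commute[of w u]
          algebra_simps)
    also have "\<beta> * (r * D) = sin R + \<epsilon> / r" using r Dp by (simp add: \<beta>_def)
    finally have "sin r / r * (e \<bullet> p - (w \<bullet> e) * b) - (w \<bullet> e) * D > 0"
      using uz eps r by (smt (verit) divide_pos_pos)
    from has_real_derivative_pos_inc_right[OF dpsi this] obtain d where
      d: "d > 0" "\<And>h. 0 < h \<Longrightarrow> h < d \<Longrightarrow> \<psi> e 0 < \<psi> e h" by auto
    have "eventually (\<lambda>t. cos R \<le> \<psi> e t) (at_right 0)"
      unfolding eventually_at_right_field using d psi0[of e] act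
      by (intro exI[of _ d]) (auto intro: less_imp_le)
    then have "u \<bullet> e \<le> 0" using vt ip by (intro dir) (auto simp: e_def inner_simps tangent_space_def)
    then have "1 \<le> \<beta> * (u \<bullet> v)" by (simp add: e_def inner_simps ip)
    then have "r * D \<le> (sin R + \<epsilon> / r) * (u \<bullet> v)" using r Dp by (simp add: \<beta>_def pos_le_divide_eq)
    moreover have "\<epsilon> / r * (u \<bullet> v) \<le> \<epsilon> / r * r"
      using Cauchy_Schwarz_ineq2[of u v] u(2) eps r by (intro mult_left_mono) (auto simp: r_def)
    ultimately show ?thesis using r by (simp add: distrib_right)
  qed
  then have "r * D \<le> sin R * (u \<bullet> v)" by (rule field_le_epsilon)
  moreover have "r * (cos R * (r / 2)) \<le> r * D" using D r by (intro mult_left_mono) auto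
  ultimately have "r\<^sup>2 * cos R \<le> 2 * sin R * (u \<bullet> v)" by (simp add: power2_eq_square mult_ac)
  then show ?thesis using cosR_pos by (simp add: r_def[symmetric] tan_def field_simps)
qed

text \<open>Minimizing against the gradient is maximizing against the opposite unit vector
  \<open>u\<close>, and the gap is the gradient norm times \<open>u \<bullet> v\<close>.\<close>

lemma fw_direction_scaling:
  assumes x: "x \<in> X" and G: "sphere_grad f x \<in> tangent_space x" and v: "v \<in> fw_argmin X f x"
  shows "norm (sphere_grad f x) * (norm v)\<^sup>2 \<le> 2 * tan R * fw_gap f x v"
proof (cases "sphere_grad f x = 0")
  case True
  then show ?thesis by (simp add: fw_gap_def)
next
  case False
  define n where "n = norm (sphere_grad f x)"
  have n: "n > 0" using False by (simp add: n_def)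
  define u where "u = (- 1 / n) *\<^sub>R sphere_grad f x"
  have u: "u \<in> tangent_space x" "norm u = 1" using G n by (auto simp: u_def n_def tangent_space_def)
  have vf: "v \<in> feasible_velocities X x" using v by (simp add: fw_argmin_def is_arg_min_def)
  have "u \<bullet> z \<le> u \<bullet> v" if "z \<in> feasible_velocities X x" for z
    using v n that by (fastforce simp: fw_argmin_def is_arg_min_linorder u_def divide_le_cancel)
  then have "(norm v)\<^sup>2 \<le> 2 * tan R * (u \<bullet> v)" by (rule maximal_velocity_scaling[OF x vf u])
  then have "n * (norm v)\<^sup>2 \<le> n * (2 * tan R * (u \<bullet> v))" using n by (intro mult_left_mono) auto
  also have "\<dots> = 2 * tan R * (n * (u \<bullet> v))" by simp
  also have "n * (u \<bullet> v) = fw_gap f x v" using n by (simp add: u_def fw_gap_def)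
  finally show ?thesis by (simp add: n_def)
qed

end

text \<open>Justifies the definite description in \<open>sphere_grad\<close>: \<open>U\<close> is
  relatively open, so derivatives within \<open>U\<close> and within the sphere agree at
  \<open>x\<close>.\<close>

lemma has_derivative_sphere_grad:
  fixes x :: "'a::euclidean_space"
  assumes "openin (top_of_set (sphere 0 1)) U" "x \<in> U" "f differentiable_on U"
  shows "sphere_grad f x \<in> tangent_space x"
    "(f has_derivative (\<lambda>v. sphere_grad f x \<bullet> v)) (at x within sphere 0 1)"
proof -
  have x: "x \<in> sphere 0 1" using assms openin_imp_subset by blast
  obtain T where T: "open T" "U = sphere 0 1 \<inter> T" using assms(1) by (auto simp: openin_open)
  have "f differentiable (at x within U)" using assms by (simp add: differentiable_on_def)
  moreover have "at x within U = at x within sphere 0 1"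
    using T assms(2) by (intro at_within_nhd[of x T]) auto
  ultimately have "f differentiable (at x within sphere 0 1)" by simp
  from sphere_grad_exists[OF x this] sphere_grad_unique[OF x]
  have "\<exists>!g. g \<in> tangent_space x \<and> (f has_derivative (\<lambda>v. g \<bullet> v)) (at x within sphere 0 1)" by blast
  from theI'[OF this] show "sphere_grad f x \<in> tangent_space x"
    "(f has_derivative (\<lambda>v. sphere_grad f x \<bullet> v)) (at x within sphere 0 1)"
    by (auto simp: sphere_grad_def)
qed

text \<open>If the initial slope exceeded that of the chord, \<open>f\<close> would rise above the
  chord for small positive times.\<close>

lemma convex_along_geodesic_ge_tangent:
  fixes x w :: "'a::euclidean_space"
  assumes x: "x \<in> sphere 0 1" and w: "w \<in> tangent_space x" "norm w = 1"
    and D: "(f has_derivative (\<lambda>v. g \<bullet> v)) (at x within sphere 0 1)"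
    and le: "\<And>t. t \<in> {0..1} \<Longrightarrow> f (sphere_exp x (t *\<^sub>R (r *\<^sub>R w))) \<le> (1 - t) * f x + t * F"
  shows "g \<bullet> (r *\<^sub>R w) \<le> F - f x"
proof (rule ccontr)
  assume neg: "\<not> ?thesis"
  \<comment> \<open>The curve is taken on the whole real line, so that \<open>f\<close> along it has
    a two-sided derivative at 0.\<close>
  define \<gamma> where "\<gamma> t = sphere_exp x ((t * r) *\<^sub>R w)" for t
  have \<gamma>: "\<gamma> t = cos (t * r) *\<^sub>R x + sin (t * r) *\<^sub>R w" for t
    by (simp add: \<gamma>_def sphere_exp_scaleR[OF x w])
  have d: "(\<gamma> has_derivative (\<lambda>t. t *\<^sub>R (r *\<^sub>R w))) (at 0)"
  proof -
    have "(\<gamma> has_vector_derivative r *\<^sub>R w) (at 0)" unfolding \<gamma>[abs_def]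
      by (auto intro!: derivative_eq_intros)
    then show ?thesis by (simp add: has_vector_derivative_def)
  qed
  have "range \<gamma> \<subseteq> sphere 0 1" using sphere_exp_in_sphere[OF x w] unfolding \<gamma>_def by blast
  moreover have g0: "\<gamma> 0 = x" by (simp add: \<gamma>)
  ultimately have "(f has_derivative (\<lambda>v. g \<bullet> v)) (at (\<gamma> 0) within range \<gamma>)"
    using D by (auto intro: has_derivative_subset)
  from has_derivative_in_compose[OF d this]
  have "((\<lambda>t. f (\<gamma> t)) has_derivative (\<lambda>t. (g \<bullet> (r *\<^sub>R w)) * t)) (at 0)"
    by (simp add: mult_ac)
  then have "((\<lambda>t. f (\<gamma> t)) has_real_derivative g \<bullet> (r *\<^sub>R w)) (at 0)"
    by (simp add: has_field_derivative_def)
  then have "((\<lambda>t. f (\<gamma> t) - ((1 - t) * f x + t * F)) has_real_derivative g \<bullet> (r *\<^sub>R w) - (F - f x)) (at 0)"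
    by (auto intro!: derivative_eq_intros)
  from has_real_derivative_pos_inc_right[OF this] neg obtain d where d: "d > 0"
    "\<And>h. 0 < h \<Longrightarrow> h < d \<Longrightarrow> f (\<gamma> 0) - f x < f (\<gamma> h) - ((1 - h) * f x + h * F)"
    by auto
  define h where "h = min 1 (d / 2)"
  have h: "0 < h" "h < d" "h \<in> {0..1}" using d by (auto simp: h_def)
  have "f (\<gamma> h) \<le> (1 - h) * f x + h * F" using le[OF h(3)] by (simp add: \<gamma>_def)
  then show False using d(2)[OF h(1,2)] g0 by simp
qed

section \<open>Frank-Wolfe on a cap\<close>

locale frank_wolfe_cap = spherical_cap p R X
  for p :: "'a::euclidean_space" and R X +
  fixes f :: "'a \<Rightarrow> real" and U :: "'a set" and L \<nu> fstar :: real
  assumes U: "openin (top_of_set (sphere 0 1)) U" "X \<subseteq> U"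
    and f: "f differentiable_on U"
    and L: "L > 0"
    and reg: "fw_regular X f L"
    and fstar: "fstar = (INF y\<in>X. f y)"
    and \<nu>: "\<nu> = (INF y\<in>X. norm (sphere_grad f y))" "\<nu> > 0"
begin

text \<open>Half of the constant \<open>M_R\<close> of the paper.\<close>

definition \<rho> :: real where "\<rho> = L * tan R / \<nu>"

lemma rho_nonneg: "\<rho> \<ge> 0"
  using L \<nu>(2) R tan_gt_zero[of R] by (simp add: \<rho>_def)

lemma argmin_feasible: "v \<in> fw_argmin X f x \<Longrightarrow> v \<in> feasible_velocities X x"
  by (simp add: fw_argmin_def is_arg_min_def)

text \<open>First-order convexity along the geodesic to \<open>y\<close>, whose initial velocity
  competes with \<open>v\<close> in the linear subproblem.\<close>

lemma gap_dominates:
  assumes x: "x \<in> X" and v: "v \<in> fw_argmin X f x" and y: "y \<in> X"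
  shows "f x - f y \<le> fw_gap f x v"
proof -
  have xs: "x \<in> sphere 0 1" using x by (simp add: X_iff)
  obtain r w where rw: "w \<in> tangent_space x" "norm w = 1" "r *\<^sub>R w \<in> feasible_velocities X x"
    "sphere_exp x (r *\<^sub>R w) = y" using log_exists[OF x y] by metis
  have "sphere_grad f x \<bullet> v \<le> sphere_grad f x \<bullet> (r *\<^sub>R w)"
    using v rw(3) unfolding fw_argmin_def is_arg_min_linorder by blast
  also have "\<dots> \<le> f y - f x"
  proof (rule convex_along_geodesic_ge_tangent[OF xs rw(1,2)])
    show "(f has_derivative (\<bullet>) (sphere_grad f x)) (at x within sphere 0 1)"
      using has_derivative_sphere_grad(2)[OF U(1) _ f] x U(2) by blast
    show "f (sphere_exp x (t *\<^sub>R (r *\<^sub>R w))) \<le> (1 - t) * f x + t * f y" if "t \<in> {0..1}" for t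
      using reg x rw that unfolding fw_regular_def by blast
  qed
  finally show ?thesis by (simp add: fw_gap_def)
qed

text \<open>The gap at a single point already bounds \<open>f\<close> from below on
  \<open>X\<close>, so the infimum \<open>fstar\<close> is not a default value.\<close>

lemma bdd_below_f: "bdd_below (f ` X)"
proof (cases "X = {}")
  case False
  then obtain x where x: "x \<in> X" by blast
  then obtain v where v: "v \<in> fw_argmin X f x" using fw_argmin_nonempty by blast
  show ?thesis
    using gap_dominates[OF x v] by (intro bdd_belowI2[of _ "f x - fw_gap f x v"]) (simp add: algebra_simps)
qed simp

lemma fstar_le: "x \<in> X \<Longrightarrow> fstar \<le> f x"
  unfolding fstar by (rule cINF_lower[OF bdd_below_f])

lemma subopt_le_gap:
  assumes x: "x \<in> X" and v: "v \<in> fw_argmin X f x"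
  shows "f x - fstar \<le> fw_gap f x v"
proof -
  have "f x - fw_gap f x v \<le> fstar" unfolding fstar
    by (rule cINF_greatest) (use x gap_dominates[OF x v] in \<open>auto simp: algebra_simps\<close>)
  then show ?thesis by simp
qed

text \<open>Here the curvature of the cap and the lower bound \<nu> on the gradient meet: a short
  gap forces a short direction, so the smoothness error is proportional to the gap.\<close>

lemma quadratic_term_le_gap:
  assumes x: "x \<in> X" and v: "v \<in> fw_argmin X f x"
  shows "L / 2 * (norm v)\<^sup>2 \<le> \<rho> * fw_gap f x v"
proof -
  have "\<nu> \<le> norm (sphere_grad f x)" unfolding \<nu>(1)
    by (rule cINF_lower) (use x in \<open>auto intro: bdd_belowI2[of _ 0]\<close>)
  then have "\<nu> * (norm v)\<^sup>2 \<le> norm (sphere_grad f x) * (norm v)\<^sup>2" by (intro mult_right_mono) auto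
  also have "\<dots> \<le> 2 * tan R * fw_gap f x v"
    using fw_direction_scaling[OF x has_derivative_sphere_grad(1)[OF U(1) _ f] v] x U(2) by blast
  finally have "L * (\<nu> * (norm v)\<^sup>2) \<le> L * (2 * tan R * fw_gap f x v)"
    using L by (intro mult_left_mono) auto
  then show ?thesis using \<nu>(2) by (simp add: \<rho>_def field_simps)
qed

lemma step_descent:
  assumes x: "x \<in> X" and v: "v \<in> fw_argmin X f x" and \<eta>: "\<eta> \<in> {0..1}"
  shows "f (sphere_exp x (\<eta> *\<^sub>R v)) \<le> f x - \<eta> * fw_gap f x v + L / 2 * (norm v)\<^sup>2 * \<eta>\<^sup>2"
  using reg x argmin_feasible[OF v] \<eta> by (force simp: fw_regular_def fw_gap_def mult_ac)

lemma step_size: "a \<ge> 2 \<Longrightarrow> a / (real k + a) \<in> {0..1}"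
  by simp

lemma prefix_in_X:
  assumes a: "a \<ge> 2" and run: "rfw_ol_prefix a X f x v k"
  shows "x k \<in> X"
  using run
proof (induction k)
  case 0
  then show ?case by (simp add: rfw_ol_prefix_def)
next
  case (Suc k)
  then have "v k \<in> feasible_velocities X (x k)" "x (Suc k) = sphere_exp (x k) ((a / (real k + a)) *\<^sub>R v k)"
    by (auto simp: rfw_ol_prefix_def intro: argmin_feasible)
  then show ?case using step_size[OF a, of k] by (auto simp: feasible_velocities_def)
qed

text \<open>A vanishing gap certifies optimality by \<open>gap_dominates\<close>; if no gap
  vanishes, every prefix extends by one step.\<close>

lemma execution_cases:
  assumes a: "a \<ge> 2" and run: "rfw_ol_execution a X f x v"
  shows "(\<exists>k. rfw_ol_terminates a X f x v k \<and> is_arg_min f (\<lambda>y. y \<in> X) (x k)) \<or> rfw_ol_infinite a X f x v"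
proof (cases "\<exists>k. rfw_ol_terminates a X f x v k")
  case True
  then obtain k where k: "rfw_ol_terminates a X f x v k" by blast
  then have x: "x k \<in> X" using prefix_in_X[OF a] by (auto simp: rfw_ol_terminates_def)
  have "f (x k) \<le> f y" if "y \<in> X" for y
    using gap_dominates[OF x _ that, of "v k"] k by (simp add: rfw_ol_terminates_def)
  then show ?thesis using k x by (auto simp: is_arg_min_linorder)
next
  case False
  have "rfw_ol_prefix a X f x v k" for k
  proof (induction k)
    case 0
    have "x 0 \<in> X" using run unfolding rfw_ol_execution_def by blast
    then show ?case by (simp add: rfw_ol_prefix_def)
  next
    case (Suc k)
    then have v: "v k \<in> fw_argmin X f (x k)" and step: "fw_gap f (x k) (v k) \<noteq> 0 \<longrightarrow>
        x (Suc k) = sphere_exp (x k) ((a / (real k + a)) *\<^sub>R v k)"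
      using run unfolding rfw_ol_execution_def by blast+
    have "fw_gap f (x k) (v k) \<noteq> 0"
      using v False Suc unfolding rfw_ol_terminates_def by blast
    with v step Suc show ?case by (simp add: rfw_ol_prefix_def less_Suc_eq all_conj_distrib)
  qed
  then show ?thesis by (simp add: rfw_ol_infinite_def)
qed

end

section \<open>Convergence rates along an infinite run\<close>

locale frank_wolfe_cap_run = frank_wolfe_cap p R X f U L \<nu> fstar
  for p :: "'a::euclidean_space" and R X f U L \<nu> fstar +
  fixes a :: real and x v :: "nat \<Rightarrow> 'a"
  assumes a: "a \<ge> 2" and run: "rfw_ol_infinite a X f x v"
begin

abbreviation h where "h k \<equiv> f (x k) - fstar"
abbreviation g where "g k \<equiv> fw_gap f (x k) (v k)"

lemma iterate: "x k \<in> X" "v k \<in> fw_argmin X f (x k)"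
    "x (Suc k) = sphere_exp (x k) ((a / (real k + a)) *\<^sub>R v k)"
proof -
  have "rfw_ol_prefix a X f x v (Suc k)" "rfw_ol_prefix a X f x v k"
    using run by (auto simp: rfw_ol_infinite_def)
  then show "x k \<in> X" "v k \<in> fw_argmin X f (x k)"
    "x (Suc k) = sphere_exp (x k) ((a / (real k + a)) *\<^sub>R v k)"
    by (blast intro: prefix_in_X[OF a], simp_all add: rfw_ol_prefix_def)
qed

lemma h_nonneg: "0 \<le> h k" using fstar_le[OF iterate(1)] by simp

lemma h_le_g: "h k \<le> g k" by (rule subopt_le_gap[OF iterate(1,2)])

lemma h_step: "h (Suc k) \<le> h k - a / (real k + a) * g k + L / 2 * (norm (v k))\<^sup>2 * (a / (real k + a))\<^sup>2"
  using step_descent[OF iterate(1,2)[of k] step_size[OF a, of k]] unfolding iterate(3) by linarith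

lemma h_step_curved: "h (Suc k) \<le> h k - a / (real k + a) * g k + \<rho> * (a / (real k + a))\<^sup>2 * g k"
proof -
  have "L / 2 * (norm (v k))\<^sup>2 * (a / (real k + a))\<^sup>2 \<le> \<rho> * g k * (a / (real k + a))\<^sup>2"
    using quadratic_term_le_gap[OF iterate(1,2)] by (intro mult_right_mono) auto
  also have "\<dots> = \<rho> * (a / (real k + a))\<^sup>2 * g k" by simp
  finally show ?thesis using h_step[of k] by linarith
qed

text \<open>The classical recursion, based on the diameter alone; it supplies the value at
  \<open>K\<close> from which the faster contraction starts.\<close>

lemma h_step_diameter: "h (Suc k) \<le> (1 - a / (real k + a)) * h k + 2 * L * R\<^sup>2 * (a / (real k + a))\<^sup>2"
proof -
  have "norm (v k) \<le> 2 * R"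
    using feasible_velocity_norm[OF iterate(1) argmin_feasible[OF iterate(2)]] .
  then have "(norm (v k))\<^sup>2 \<le> (2 * R)\<^sup>2" by (intro power_mono) auto
  then have "L / 2 * (norm (v k))\<^sup>2 \<le> L / 2 * (2 * R)\<^sup>2" using L by (intro mult_left_mono) auto
  then have "L / 2 * (norm (v k))\<^sup>2 * (a / (real k + a))\<^sup>2 \<le> 2 * L * R\<^sup>2 * (a / (real k + a))\<^sup>2"
    by (intro mult_right_mono) (auto simp: power_mult_distrib)
  moreover have "a / (real k + a) * h k \<le> a / (real k + a) * g k"
    using h_le_g a by (intro mult_left_mono) auto
  ultimately have "h k - a / (real k + a) * g k + L / 2 * (norm (v k))\<^sup>2 * (a / (real k + a))\<^sup>2
    \<le> h k - a / (real k + a) * h k + 2 * L * R\<^sup>2 * (a / (real k + a))\<^sup>2"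
    by (intro add_mono diff_left_mono)
  also have "h k - a / (real k + a) * h k = (1 - a / (real k + a)) * h k"
    by (simp only: left_diff_distrib[of 1] mult_1)
  finally show ?thesis using h_step[of k] by linarith
qed

lemma h_rate:
  assumes K: "K \<ge> 1" "a * \<rho> \<le> real K + a" and k: "k \<ge> K"
  shows "h k \<le> 2 * a\<^sup>2 * L * R\<^sup>2 / (real K + a - 1) * exp (a\<^sup>2 * \<rho> / (real K + a - 1))
    * ((real K + a) / (real k + a)) powr a"
proof -
  \<comment> \<open>\<open>open_loop_sublinear\<close> bounds \<open>h (Suc k)\<close> with
    denominator \<open>k + a\<close>; the shift by one produces \<open>K + a - 1\<close>.\<close>
  have "h (Suc (K - 1)) \<le> 2 * L * R\<^sup>2 * a\<^sup>2 / (real (K - 1) + a)"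
    by (rule open_loop_sublinear[OF a _ h_step_diameter]) (use L in auto)
  then have "h K \<le> 2 * a\<^sup>2 * L * R\<^sup>2 / (real K + a - 1)" using K by (simp add: of_nat_diff mult_ac diff_add_eq)
  then have "h K * exp (a\<^sup>2 * \<rho> / (real K + a - 1)) * ((real K + a) / (real k + a)) powr a
    \<le> 2 * a\<^sup>2 * L * R\<^sup>2 / (real K + a - 1) * exp (a\<^sup>2 * \<rho> / (real K + a - 1)) * ((real K + a) / (real k + a)) powr a"
    by (intro mult_right_mono) auto
  with open_loop_contraction[OF a K(1) rho_nonneg K(2) h_nonneg h_le_g h_step_curved k]
  show ?thesis by linarith
qed

text \<open>For \<open>k \<ge> 2\<close> the index set is nonempty, so \<open>Min\<close> is a
  genuine minimum.\<close>

lemma gap_rec_bounds: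
  assumes "k \<ge> 2"
  shows "0 \<le> gap_rec f x v k" "k div 2 \<le> j \<Longrightarrow> j < k \<Longrightarrow> gap_rec f x v k \<le> g j"
proof -
  have "0 \<le> g j" for j using h_nonneg[of j] h_le_g[of j] by linarith
  then show "0 \<le> gap_rec f x v k" using assms unfolding gap_rec_def by (subst Min_ge_iff) auto
  show "k div 2 \<le> j \<Longrightarrow> j < k \<Longrightarrow> gap_rec f x v k \<le> g j" unfolding gap_rec_def by (intro Min_le) auto
qed

lemma gap_rec_rate:
  assumes "2 * a * \<rho> \<le> real (k div 2) + a" "real k \<ge> 2 * a"
  shows "gap_rec f x v k \<le> 2 * h (k div 2) / (a * ln (3 / 2))"
proof -
  have "real k \<ge> 2" using assms a by linarith
  then have "k \<ge> 2" by simp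
  show ?thesis
    by (rule open_loop_gap[OF a refl assms h_nonneg h_le_g h_step_curved gap_rec_bounds[OF \<open>k \<ge> 2\<close>]])
qed

lemma h_bigo: "h \<in> O(\<lambda>k. real k powr (- a))"
proof -
  \<comment> \<open>Any admissible threshold will do for the asymptotics; this one avoids
    subtracting \<open>a\<close>.\<close>
  define K where "K = max 1 (nat \<lceil>a * \<rho>\<rceil>)"
  have K: "K \<ge> 1" "a * \<rho> \<le> real K + a" using a unfolding K_def by linarith+
  define C where "C = 2 * a\<^sup>2 * L * R\<^sup>2 / (real K + a - 1) * exp (a\<^sup>2 * \<rho> / (real K + a - 1)) * (real K + a) powr a"
  have C: "C \<ge> 0" using L a by (simp add: C_def)
  have "norm (h k) \<le> C * norm (real k powr (- a))" if k: "k \<ge> K" for k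
  proof -
    have k0: "real k > 0" using k K by simp
    have "h k \<le> C * (real k + a) powr (- a)"
      using h_rate[OF K k] a by (simp add: C_def powr_divide powr_minus field_simps)
    also have "\<dots> \<le> C * real k powr (- a)"
      using C k0 a by (intro mult_left_mono powr_mono2') auto
    finally show ?thesis using h_nonneg by simp
  qed
  then show ?thesis by (intro bigoI[of _ C]) (auto simp: eventually_at_top_linorder)
qed

lemma gap_rec_bigo: "gap_rec f x v \<in> O(\<lambda>k. real k powr (- a))"
proof -
  obtain C where C: "C > 0" and hC: "eventually (\<lambda>k. norm (h k) \<le> C * norm (real k powr (- a))) at_top"
    using h_bigo by (elim landau_o.bigE)
  from hC have "eventually (\<lambda>k. h k \<le> C * real k powr (- a)) at_top"
    by (rule eventually_mono) (simp add: h_nonneg)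
  then obtain N where N: "\<And>k. k \<ge> N \<Longrightarrow> h k \<le> C * real k powr (- a)"
    unfolding eventually_at_top_linorder by blast
  \<comment> \<open>Beyond \<open>M\<close> the index \<open>m = k div 2\<close> is in the range of
    the bound on \<open>h\<close>, \<open>gap_rec_rate\<close> applies, and
    \<open>m \<ge> k / 4\<close>; the last accounts for the factor \<open>4 powr a\<close> in
    \<open>B\<close>.\<close>
  define M where "M = max (2 * N) (max 4 (max (nat \<lceil>2 * a\<rceil>) (2 * nat \<lceil>2 * a * \<rho>\<rceil>)))"
  define B where "B = 2 / (a * ln (3 / 2)) * (C * 4 powr a)"
  have c: "0 \<le> 2 / (a * ln (3 / 2))" using a by simp
  have "norm (gap_rec f x v k) \<le> B * norm (real k powr (- a))" if k: "k \<ge> M" for k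
  proof -
    define m where "m = k div 2"
    have m: "m \<ge> N" "m \<ge> nat \<lceil>2 * a * \<rho>\<rceil>" "k \<ge> 4" "k \<ge> nat \<lceil>2 * a\<rceil>"
      using k unfolding M_def m_def by linarith+
    have mr: "2 * a * \<rho> \<le> real m" using m(2) by linarith
    have m4: "real k / 4 \<le> real m" "real k / 4 > 0" using \<open>k \<ge> 4\<close> unfolding m_def by linarith+
    have "gap_rec f x v k \<le> 2 * h m / (a * ln (3 / 2))"
      unfolding m_def by (rule gap_rec_rate) (use mr m(4) a in \<open>unfold m_def, linarith+\<close>)
    also have "\<dots> = 2 / (a * ln (3 / 2)) * h m" by simp
    also have "\<dots> \<le> 2 / (a * ln (3 / 2)) * (C * real m powr (- a))"
      using N[OF m(1)] c by (rule mult_left_mono)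
    also have "\<dots> \<le> 2 / (a * ln (3 / 2)) * (C * (real k / 4) powr (- a))"
      using m4 C a c by (intro mult_left_mono powr_mono2') auto
    also have "\<dots> = B * real k powr (- a)" by (simp add: B_def powr_divide powr_minus field_simps)
    finally show ?thesis using gap_rec_bounds(1)[of k] \<open>k \<ge> 4\<close> by simp
  qed
  then show ?thesis by (intro bigoI[of _ B]) (auto simp: eventually_at_top_linorder)
qed

end

text \<open>The first conjunct records well-posedness: a direction exists at every reached iterate,
  so an execution never gets stuck.\<close>

theorem corollary5p6:
  fixes p :: "'a::euclidean_space"
    and R L a \<nu> fstar :: real
    and X U :: "'a set"
    and f :: "'a \<Rightarrow> real"
    and K Khat :: int
  assumes dim: "DIM('a) \<ge> 2"
    and p: "p \<in> sphere 0 1"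
    and R: "0 < R" "R < pi / 2"
    and X: "X = sphere_cball p R"
    and U: "openin (top_of_set (sphere 0 1)) U" "X \<subseteq> U"
    and f: "f differentiable_on U"
    and L: "L > 0"
    and reg: "fw_regular X f L"
    and fstar: "fstar = (INF y\<in>X. f y)"
    and \<nu>: "\<nu> = (INF y\<in>X. norm (sphere_grad f y))" "\<nu> > 0"
    and a: "a \<ge> 2"
    and K: "K = max 1 \<lceil>a * L * tan R / \<nu> - a\<rceil>"
    and Khat: "Khat = max K \<lceil>2 * a * L * tan R / \<nu> - a\<rceil>"
  shows
    "(\<forall>x v k. rfw_ol_prefix a X f x v k \<longrightarrow> x k \<in> X \<and> fw_argmin X f (x k) \<noteq> {}) \<and>
     (\<forall>x v. rfw_ol_execution a X f x v \<longrightarrow>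
        (\<exists>k. rfw_ol_terminates a X f x v k \<and> is_arg_min f (\<lambda>y. y \<in> X) (x k)) \<or>
        rfw_ol_infinite a X f x v) \<and>
     (\<forall>x v. rfw_ol_infinite a X f x v \<longrightarrow>
        (\<forall>k. int k \<ge> K \<longrightarrow>
           f (x k) - fstar \<le> 2 * a\<^sup>2 * L * R\<^sup>2 / (of_int K + a - 1)
             * exp (a\<^sup>2 * L * tan R / (\<nu> * (of_int K + a - 1)))
             * ((of_int K + a) / (real k + a)) powr a) \<and>
        (\<forall>k. int (k div 2) \<ge> Khat \<and> int k \<ge> \<lceil>2 * a\<rceil> \<longrightarrow>
           gap_rec f x v k \<le> 2 * (f (x (k div 2)) - fstar) / (a * ln (3 / 2))) \<and>
        (\<lambda>k. f (x k) - fstar) \<in> O(\<lambda>k. real k powr (- a)) \<and>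
        gap_rec f x v \<in> O(\<lambda>k. real k powr (- a)))"
proof -
  interpret frank_wolfe_cap p R X f U L \<nu> fstar
    by unfold_locales (use assms in auto)
  have K1: "K \<ge> 1" using K by simp
  have KN: "of_int K = real (nat K)" using K1 by simp
  have rhoK: "a * \<rho> \<le> real (nat K) + a"
  proof -
    have "\<lceil>a * \<rho> - a\<rceil> \<le> K" by (simp add: K \<rho>_def mult.assoc)
    then have "a * \<rho> - a \<le> of_int K" by linarith
    then show ?thesis by (simp add: KN)
  qed
  have rhoKhat: "2 * a * \<rho> \<le> of_int Khat + a"
  proof -
    have "\<lceil>2 * a * \<rho> - a\<rceil> \<le> Khat" by (simp add: Khat \<rho>_def mult.assoc)
    then show ?thesis by linarith
  qed
  show ?thesis
  proof (intro conjI allI impI)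
    fix x v k assume "rfw_ol_prefix a X f x v k"
    then show "x k \<in> X" by (rule prefix_in_X[OF a])
    then show "fw_argmin X f (x k) \<noteq> {}" by (rule fw_argmin_nonempty)
  next
    fix x v assume "rfw_ol_execution a X f x v"
    then show "(\<exists>k. rfw_ol_terminates a X f x v k \<and> is_arg_min f (\<lambda>y. y \<in> X) (x k)) \<or>
        rfw_ol_infinite a X f x v" by (rule execution_cases[OF a])
  next
    fix x v assume inf: "rfw_ol_infinite a X f x v"
    interpret frank_wolfe_cap_run p R X f U L \<nu> fstar a x v
      by unfold_locales (fact a inf)+
    show "(\<lambda>k. f (x k) - fstar) \<in> O(\<lambda>k. real k powr (- a))" by (rule h_bigo)
    show "gap_rec f x v \<in> O(\<lambda>k. real k powr (- a))" by (rule gap_rec_bigo)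
    fix k
    {
      assume "int k \<ge> K"
      then have "f (x k) - fstar \<le> 2 * a\<^sup>2 * L * R\<^sup>2 / (real (nat K) + a - 1)
          * exp (a\<^sup>2 * \<rho> / (real (nat K) + a - 1)) * ((real (nat K) + a) / (real k + a)) powr a"
        using K1 by (intro h_rate rhoK) auto
      moreover have "a\<^sup>2 * \<rho> / (real (nat K) + a - 1) = a\<^sup>2 * L * tan R / (\<nu> * (real (nat K) + a - 1))"
        by (simp add: \<rho>_def)
      ultimately show "f (x k) - fstar \<le> 2 * a\<^sup>2 * L * R\<^sup>2 / (of_int K + a - 1)
          * exp (a\<^sup>2 * L * tan R / (\<nu> * (of_int K + a - 1)))
          * ((of_int K + a) / (real k + a)) powr a" by (simp only: KN)
    }
    assume "int (k div 2) \<ge> Khat \<and> int k \<ge> \<lceil>2 * a\<rceil>"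
    then have "of_int Khat \<le> real (k div 2)" "2 * a \<le> real k" by linarith+
    then show "gap_rec f x v k \<le> 2 * (f (x (k div 2)) - fstar) / (a * ln (3 / 2))"
      using rhoKhat by (intro gap_rec_rate) auto
  qed
qed

end
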